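(* Let $n\ge 2$ and let $\tilde{b}_n$ denote the number of basic ideals in the Borel subalgebra $\tilde{\mathfrak b}_n$ of the untwisted affine Kac–Moody algebra $\tilde{\mathfrak g}_n$ of type $\tilde B_n$. Then $$\tilde{b}_{n} = (3n+5)\,2^{2n-2} - 2(3n-1)\binom{2n-2}{n-1}.$$
   Context: Let $\mathfrak g_n$ be the simple complex Lie algebra of type $B_n$ with triangular decomposition $\mathfrak g_n=\mathfrak n_-\oplus\mathfrak h\oplus\mathfrak n_+$. The untwisted affine Kac–Moody algebra is $\tilde{\mathfrak g}_n=(\mathfrak g_n\otimes\mathbb C[t,t^{-1}])\oplus\mathbb Cc\oplus\mathbb Cd$, where $c$ is central, $[x\otimes t^k,y\otimes t^l]=[x,y]\otimes t^{k+l}+k\,(x|y)\,\delta_{k+l,0}\,c$ with $(\cdot|\cdot)$ the Killing form of $\mathfrak g_n$, $[d,x\otimes t^k]=k\,x\otimes t^k$ and $[d,c]=0$. Put $\tilde{\mathfrak h}=\mathrm{Span}(\{c,d\}\cup\{h\otimes 1: h\in\mathfrak h\})$, $\tilde{\mathfrak n}_+=\mathrm{Span}(\{x\otimes 1:x\in\mathfrak n_+\}\cup\{x\otimes t^k:x\in\mathfrak g_n,\ k>0\})$, and $\tilde{\mathfrak b}_n=\tilde{\mathfrak h}\oplus\tilde{\mathfrak n}_+$ (the Borel subalgebra). Root spaces $\tilde{\mathfrak g}_\alpha$ are taken with respect to $\tilde{\mathfrak h}$; the positive roots are those whose root spaces lie in $\tilde{\mathfrak n}_+$. Roots of $B_n$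 are regarded as roots of $\tilde B_n$, and $\delta$ is the indivisible positive imaginary root (the root with $\tilde{\mathfrak g}_\delta=\mathfrak h\otimes t$). A combinatorial ideal is an ideal $\mathfrak i$ of $\tilde{\mathfrak b}_n$ that is contained in $\tilde{\mathfrak n}_+$, has finite codimension, and satisfies $\mathfrak i\cap\tilde{\mathfrak g}_\alpha\in\{\{0\},\tilde{\mathfrak g}_\alpha\}$ for each positive root $\alpha$. Its support $\mathrm{supp}(\mathfrak i)$ is the set of positive roots $\alpha$ with $\tilde{\mathfrak g}_\alpha\subset\mathfrak i$. Let $\Phi^+$ be the set of positive roots of $B_n$ and $D=\{\delta\}\cup\Phi^+\cup\{\delta-\gamma:\gamma\in\Phi^+\}$. A basic ideal is a combinatorial ideal $\mathfrak i$ with $\mathrm{supp}(\mathfrak i)\cap D\neq\emptyset$. *)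

theory Defs
  imports Complex_Main "HOL-Library.Function_Algebras" "HOL-Library.Product_Plus"
begin

text \<open>
  The dual of a subspace \<open>H\<close> consists of the functionals that are linear on \<open>H\<close>; since HOL functions
  are total, each of them is normalised to vanish outside \<open>H\<close>. With this convention pointwise sums and
  differences of elements of the dual are again in the dual.
\<close>

definition dual_space :: "(complex \<Rightarrow> 'a \<Rightarrow> 'a) \<Rightarrow> 'a set \<Rightarrow> ('a::ab_group_add \<Rightarrow> complex) set" where
  "dual_space scl H = {\<alpha>. (\<forall>x\<in>H. \<forall>y\<in>H. \<alpha> (x + y) = \<alpha> x + \<alpha> y)
     \<and> (\<forall>r. \<forall>x\<in>H. \<alpha> (scl r x) = r * \<alpha> x) \<and> (\<forall>x. x \<notin> H \<longrightarrow> \<alpha> x = 0)}"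

definition weight_space ::
    "(complex \<Rightarrow> 'a \<Rightarrow> 'a) \<Rightarrow> ('a \<Rightarrow> 'a \<Rightarrow> 'a) \<Rightarrow> 'a set \<Rightarrow> 'a set \<Rightarrow> ('a \<Rightarrow> complex) \<Rightarrow> 'a set" where
  "weight_space scl br L H \<alpha> = {x \<in> L. \<forall>h\<in>H. br h x = scl (\<alpha> h) x}"

definition roots ::
    "(complex \<Rightarrow> 'a \<Rightarrow> 'a) \<Rightarrow> ('a \<Rightarrow> 'a \<Rightarrow> 'a) \<Rightarrow> 'a set \<Rightarrow> 'a set \<Rightarrow> ('a::ab_group_add \<Rightarrow> complex) set" where
  "roots scl br L H = {\<alpha> \<in> dual_space scl H. \<alpha> \<noteq> 0 \<and> weight_space scl br L H \<alpha> \<noteq> {0}}"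

text \<open>
  The simple Lie algebra of type \<open>B\<^sub>n\<close> is realised as \<open>so(2n+1)\<close> with respect to the form
  \<open>x\<^sub>0 y\<^sub>0 + (\<Sum>i=1..n. x\<^sub>i y\<^sub>-\<^sub>i + x\<^sub>-\<^sub>i y\<^sub>i)\<close>. Rows and columns of the \<open>(2n+1) \<times> (2n+1)\<close> matrices are
  indexed by \<open>-n, \<dots>, n\<close>; a matrix is a function on all of \<open>int \<times> int\<close> that vanishes elsewhere.
  The condition \<open>A\<^sup>T S + S A = 0\<close>, where \<open>S\<close> is the Gram matrix of the form, then reads
  \<open>A (- j) (- i) = - A i j\<close>.
\<close>

type_synonym matrix = "int \<Rightarrow> int \<Rightarrow> complex"

definition mat_scale :: "complex \<Rightarrow> matrix \<Rightarrow> matrix" where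
  "mat_scale r A = (\<lambda>i j. r * A i j)"

interpretation matv: vector_space mat_scale
  by unfold_locales (auto simp: mat_scale_def fun_eq_iff algebra_simps)

definition so :: "nat \<Rightarrow> matrix set" where
  "so n = {A. (\<forall>i j. A i j \<noteq> 0 \<longrightarrow> \<bar>i\<bar> \<le> int n \<and> \<bar>j\<bar> \<le> int n) \<and> (\<forall>i j. A (- j) (- i) = - A i j)}"

definition mat_bracket :: "nat \<Rightarrow> matrix \<Rightarrow> matrix \<Rightarrow> matrix" where
  "mat_bracket n A B = (\<lambda>i j. \<Sum>k = - int n..int n. A i k * B k j - B i k * A k j)"

text \<open>For this form the upper triangular matrices in \<open>so n\<close> are a Borel subalgebra, and the diagonal ones
  are a Cartan subalgebra.\<close>

definition cartan :: "nat \<Rightarrow> matrix set" where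
  "cartan n = {A \<in> so n. \<forall>i j. A i j \<noteq> 0 \<longrightarrow> i = j}"

definition nilp :: "nat \<Rightarrow> matrix set" where
  "nilp n = {A \<in> so n. \<forall>i j. A i j \<noteq> 0 \<longrightarrow> i < j}"

definition fin_root_space :: "nat \<Rightarrow> (matrix \<Rightarrow> complex) \<Rightarrow> matrix set" where
  "fin_root_space n = weight_space mat_scale (mat_bracket n) (so n) (cartan n)"

definition fin_pos_roots :: "nat \<Rightarrow> (matrix \<Rightarrow> complex) set" where
  "fin_pos_roots n = {\<gamma> \<in> roots mat_scale (mat_bracket n) (so n) (cartan n).
     fin_root_space n \<gamma> \<subseteq> nilp n}"

text \<open>The trace of an endomorphism \<open>T\<close> of a finite-dimensional subspace \<open>V\<close>, computed in a basis of
  \<open>V\<close> (it does not depend on the choice).\<close>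

definition trace_on :: "matrix set \<Rightarrow> (matrix \<Rightarrow> matrix) \<Rightarrow> complex" where
  "trace_on V T = (let B = (SOME B. matv.independent B \<and> matv.span B = V)
     in \<Sum>b\<in>B. matv.representation B (T b) b)"

definition killing :: "nat \<Rightarrow> matrix \<Rightarrow> matrix \<Rightarrow> complex" where
  "killing n x y = trace_on (so n) (\<lambda>z. mat_bracket n x (mat_bracket n y z))"

text \<open>The triple \<open>(f, a, b)\<close> stands for \<open>(\<Sum>k. f k \<otimes> t\<^sup>k) + a c + b d\<close>.\<close>

type_synonym aff = "(int \<Rightarrow> matrix) \<times> complex \<times> complex"

definition aff_scale :: "complex \<Rightarrow> aff \<Rightarrow> aff" where
  "aff_scale r = (\<lambda>(f, a, b). (\<lambda>k. mat_scale r (f k), r * a, r * b))"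

interpretation aff: vector_space aff_scale
  by unfold_locales
    (auto simp: aff_scale_def mat_scale_def fun_eq_iff distrib_left distrib_right mult.assoc
      simp flip: distrib_left)

definition affine_alg :: "nat \<Rightarrow> aff set" where
  "affine_alg n = {(f, a, b). finite {k. f k \<noteq> 0} \<and> (\<forall>k. f k \<in> so n)}"

definition aff_bracket :: "nat \<Rightarrow> aff \<Rightarrow> aff \<Rightarrow> aff" where
  "aff_bracket n = (\<lambda>(f, a, b) (g, a', b').
     (\<lambda>m. (\<Sum>k | f k \<noteq> 0. mat_bracket n (f k) (g (m - k)))
            + mat_scale (b * of_int m) (g m) - mat_scale (b' * of_int m) (f m),
      \<Sum>k | f k \<noteq> 0. of_int k * killing n (f k) (g (- k)),
      0))"

definition tensor_t :: "matrix \<Rightarrow> int \<Rightarrow> aff" where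
  "tensor_t x k = (\<lambda>m. if m = k then x else 0, 0, 0)"

definition c_elem :: aff where "c_elem = (0, 1, 0)"

definition d_elem :: aff where "d_elem = (0, 0, 1)"

definition aff_cartan :: "nat \<Rightarrow> aff set" where
  "aff_cartan n = aff.span ({c_elem, d_elem} \<union> {tensor_t h 0 |h. h \<in> cartan n})"

definition aff_nilp :: "nat \<Rightarrow> aff set" where
  "aff_nilp n = aff.span ({tensor_t x 0 |x. x \<in> nilp n} \<union> {tensor_t x k |x k. x \<in> so n \<and> k > 0})"

definition aff_borel :: "nat \<Rightarrow> aff set" where
  "aff_borel n = {x + y |x y. x \<in> aff_cartan n \<and> y \<in> aff_nilp n}"

definition aff_root_space :: "nat \<Rightarrow> (aff \<Rightarrow> complex) \<Rightarrow> aff set" where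
  "aff_root_space n = weight_space aff_scale (aff_bracket n) (affine_alg n) (aff_cartan n)"

definition aff_pos_roots :: "nat \<Rightarrow> (aff \<Rightarrow> complex) set" where
  "aff_pos_roots n = {\<alpha> \<in> roots aff_scale (aff_bracket n) (affine_alg n) (aff_cartan n).
     aff_root_space n \<alpha> \<subseteq> aff_nilp n}"

text \<open>A functional on the finite Cartan subalgebra is extended by zero on \<open>c\<close> and \<open>d\<close>.\<close>

definition extend_root :: "nat \<Rightarrow> (matrix \<Rightarrow> complex) \<Rightarrow> (aff \<Rightarrow> complex)" where
  "extend_root n \<gamma> = (\<lambda>x. if x \<in> aff_cartan n then \<gamma> (fst x 0) else 0)"

text \<open>The functional dual to \<open>d\<close>; its root space is \<open>\<hh> \<otimes> t\<close>, see \<open>root_space_delta\<close> below.\<close>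

definition delta :: "nat \<Rightarrow> aff \<Rightarrow> complex" where
  "delta n = (\<lambda>x. if x \<in> aff_cartan n then snd (snd x) else 0)"

definition borel_ideal :: "nat \<Rightarrow> aff set \<Rightarrow> bool" where
  "borel_ideal n I \<longleftrightarrow> aff.subspace I \<and> I \<subseteq> aff_borel n
     \<and> (\<forall>x\<in>aff_borel n. \<forall>y\<in>I. aff_bracket n x y \<in> I)"

definition finite_codim :: "aff set \<Rightarrow> aff set \<Rightarrow> bool" where
  "finite_codim V I \<longleftrightarrow> (\<exists>F. finite F \<and> F \<subseteq> V \<and> V \<subseteq> aff.span (I \<union> F))"

definition combinatorial_ideal :: "nat \<Rightarrow> aff set \<Rightarrow> bool" where
  "combinatorial_ideal n I \<longleftrightarrow> borel_ideal n I \<and> I \<subseteq> aff_nilp n \<and> finite_codim (aff_borel n) I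
     \<and> (\<forall>\<alpha>\<in>aff_pos_roots n. I \<inter> aff_root_space n \<alpha> \<in> {{0}, aff_root_space n \<alpha>})"

definition supp :: "nat \<Rightarrow> aff set \<Rightarrow> (aff \<Rightarrow> complex) set" where
  "supp n I = {\<alpha> \<in> aff_pos_roots n. aff_root_space n \<alpha> \<subseteq> I}"

definition basic_roots :: "nat \<Rightarrow> (aff \<Rightarrow> complex) set" where
  "basic_roots n = (let \<Phi> = extend_root n ` fin_pos_roots n
     in {delta n} \<union> \<Phi> \<union> {delta n - \<gamma> |\<gamma>. \<gamma> \<in> \<Phi>})"

definition basic_ideal :: "nat \<Rightarrow> aff set \<Rightarrow> bool" where
  "basic_ideal n I \<longleftrightarrow> combinatorial_ideal n I \<and> supp n I \<inter> basic_roots n \<noteq> {}"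

lemma aff_cartan_explicit:
  "aff_cartan n = {(f, a, b). f 0 \<in> cartan n \<and> (\<forall>k. k \<noteq> 0 \<longrightarrow> f k = 0)}" (is "_ = ?R")
proof
  have "0 \<in> cartan n"
    by (simp add: cartan_def so_def)
  moreover have "A + B \<in> cartan n" if "A \<in> cartan n" "B \<in> cartan n" for A B
  proof -
    have "A i j \<noteq> 0 \<or> B i j \<noteq> 0" if "(A + B) i j \<noteq> 0" for i j
      using that by auto
    moreover have "(A + B) (- j) (- i) = - (A + B) i j" for i j
      using \<open>A \<in> cartan n\<close> \<open>B \<in> cartan n\<close> by (simp add: cartan_def so_def)
    ultimately show ?thesis
      using that unfolding cartan_def so_def mem_Collect_eq by blast
  qed
  moreover have "mat_scale r A \<in> cartan n" if "A \<in> cartan n" for r A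
    using that by (auto simp: cartan_def so_def mat_scale_def)
  ultimately have sub: "aff.subspace ?R"
    unfolding aff.subspace_def by (auto simp: aff_scale_def zero_prod_def)
  show "aff_cartan n \<subseteq> ?R"
    unfolding aff_cartan_def
    by (rule aff.span_minimal[OF _ sub])
      (auto simp: c_elem_def d_elem_def tensor_t_def cartan_def so_def)
  show "?R \<subseteq> aff_cartan n"
  proof clarify
    fix f :: "int \<Rightarrow> matrix" and a b :: complex
    assume f: "f 0 \<in> cartan n" "\<forall>k. k \<noteq> 0 \<longrightarrow> f k = 0"
    have eq: "(f, a, b) = tensor_t (f 0) 0 + aff_scale a c_elem + aff_scale b d_elem"
      using f by (auto simp: tensor_t_def c_elem_def d_elem_def aff_scale_def mat_scale_def fun_eq_iff)
    show "(f, a, b) \<in> aff_cartan n"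
      unfolding eq aff_cartan_def
      using f(1) by (intro aff.span_add aff.span_scale aff.span_base) auto
  qed
qed

lemma mat_bracket_cartan:
  assumes h: "h \<in> cartan n" and A: "A \<in> so n"
  shows "mat_bracket n h A = (\<lambda>i j. (h i i - h j j) * A i j)"
proof (intro ext)
  fix i j
  have diag: "h p q = 0" if "p \<noteq> q" for p q
    using h that by (auto simp: cartan_def)
  have out: "h p p = 0" if "p \<notin> {- int n..int n}" for p
    using h that by (force simp: cartan_def so_def)
  have l: "h i k * A k j = (if k = i then h i i * A i j else 0)" for k
    using diag[of i k] by auto
  have r: "A i k * h k j = (if k = j then A i j * h j j else 0)" for k
    using diag[of k j] by auto
  show "mat_bracket n h A i j = (h i i - h j j) * A i j"
    unfolding mat_bracket_def sum_subtractf
    using out[of i] out[of j] by (subst sum.cong[OF refl l], subst sum.cong[OF refl r])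
      (auto simp: algebra_simps)
qed

lemma aff_bracket_cartan:
  assumes h: "h 0 \<in> cartan n" "\<forall>k. k \<noteq> 0 \<longrightarrow> h k = 0"
    and x: "\<forall>k. f k \<in> so n"
  shows "fst (aff_bracket n (h, p, q) (f, a, b))
    = (\<lambda>m. mat_bracket n (h 0) (f m) + mat_scale (q * of_int m) (f m))" (is ?A)
    and "snd (snd (aff_bracket n (h, p, q) (f, a, b))) = 0" (is ?B)
    and "fst (snd (aff_bracket n (h, p, q) (f, a, b))) = 0" (is ?C)
proof -
  have S: "{k. h k \<noteq> 0} = (if h 0 = 0 then {} else {0})"
    using h(2) by (auto simp del: zero_fun_apply) metis
  have z: "mat_bracket n 0 (f m) = 0" for m
    by (simp add: mat_bracket_def fun_eq_iff)
  have dh: "mat_scale (b * of_int m) (h m) = 0" for m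
    using h(2) by (cases "m = 0") (auto simp: mat_scale_def fun_eq_iff)
  show ?A
    unfolding aff_bracket_def prod.case fst_conv dh S by (auto simp: z)
  show ?B ?C
    by (auto simp: aff_bracket_def S)
qed

lemma root_space_delta: "aff_root_space n (delta n) = {tensor_t h 1 |h. h \<in> cartan n}"
proof (intro equalityI subsetI)
  fix x assume "x \<in> aff_root_space n (delta n)"
  then obtain f a b where x: "x = (f, a, b)" and f: "\<forall>k. f k \<in> so n"
    and w: "\<And>h. h \<in> aff_cartan n \<Longrightarrow> aff_bracket n h x = aff_scale (delta n h) x"
    by (cases x) (auto simp: aff_root_space_def weight_space_def affine_alg_def)
  have zero: "0 \<in> cartan n"
    by (simp add: cartan_def so_def)
  have d: "d_elem \<in> aff_cartan n"
    by (auto simp: aff_cartan_explicit d_elem_def zero)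
  have d1: "delta n d_elem = 1"
    using d by (simp add: delta_def d_elem_def)
  have wd: "aff_bracket n (0, 0, 1) (f, a, b) = (f, a, b)"
    using w[OF d] unfolding d1 x aff.scale_one by (simp add: d_elem_def)
  have ab: "a = 0" "b = 0"
    using wd aff_bracket_cartan(2,3)[of 0 n f 0 1 a b] zero f by auto
  have "mat_bracket n 0 (f m) + mat_scale (of_int m) (f m) = f m" for m
    using wd aff_bracket_cartan(1)[of 0 n f 0 1 a b] zero f by (auto simp: fun_eq_iff)
  moreover have "mat_bracket n 0 (f m) = 0" for m
    using mat_bracket_cartan[OF zero, of "f m"] f by (simp add: fun_eq_iff)
  ultimately have "mat_scale (of_int m) (f m) = f m" for m
    by simp
  then have sc: "mat_scale (of_int m - 1) (f m) = 0" for m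
    by (simp add: matv.scale_left_diff_distrib)
  then have fm: "f m = 0" if "m \<noteq> 1" for m
  proof -
    have "of_int m - 1 \<noteq> (0 :: complex)"
      using that by (simp add: of_int_eq_1_iff)
    then show ?thesis
      using sc[of m] unfolding matv.scale_eq_0_iff by (elim disjE) (erule (1) notE, assumption)
  qed
  define h :: matrix where "h = (\<lambda>i j. if i = j \<and> \<bar>i\<bar> \<le> int n then of_int i else 0)"
  have h: "h \<in> cartan n"
    by (auto simp: h_def cartan_def so_def)
  have th: "tensor_t h 0 = ((\<lambda>m. if m = 0 then h else 0), 0, 0)"
    by (simp add: tensor_t_def)
  have tc: "tensor_t h 0 \<in> aff_cartan n"
    using h by (auto simp: aff_cartan_explicit th)
  have "delta n (tensor_t h 0) = 0"
    by (simp add: delta_def th)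
  then have "aff_bracket n (tensor_t h 0) x = 0"
    using w[OF tc] by simp
  then have "mat_bracket n h (f 1) = 0"
    using aff_bracket_cartan(1)[of "\<lambda>m. if m = 0 then h else 0" n f 0 0 a b] h f
    by (auto simp: th x fun_eq_iff mat_scale_def zero_prod_def)
  then have hf: "(h i i - h j j) * f 1 i j = 0" for i j
    using mat_bracket_cartan[OF h, of "f 1"] f by (auto simp: fun_eq_iff)
  have "f 1 i j = 0" if "i \<noteq> j" for i j
  proof (rule ccontr)
    assume nz: "f 1 i j \<noteq> 0"
    then have "\<bar>i\<bar> \<le> int n \<and> \<bar>j\<bar> \<le> int n"
      using f unfolding so_def by blast
    with hf[of i j] nz that show False
      by (simp add: h_def)
  qed
  then have "f 1 \<in> cartan n"
    using f by (auto simp: cartan_def)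
  moreover have "x = tensor_t (f 1) 1"
    using fm ab by (auto simp: x tensor_t_def)
  ultimately show "x \<in> {tensor_t h 1 |h. h \<in> cartan n}"
    by blast
next
  fix x assume "x \<in> {tensor_t h 1 |h. h \<in> cartan n}"
  then obtain g where g: "g \<in> cartan n" and x: "x = ((\<lambda>m. if m = 1 then g else 0), 0, 0)"
    by (auto simp: tensor_t_def)
  have so: "\<forall>k. (if k = (1::int) then g else 0) \<in> so n"
    using g by (auto simp: cartan_def so_def)
  have "aff_bracket n y x = aff_scale (delta n y) x" if y: "y \<in> aff_cartan n" for y
  proof -
    obtain h p q where yy: "y = (h, p, q)" by (cases y)
    have h: "h 0 \<in> cartan n" "\<forall>k. k \<noteq> 0 \<longrightarrow> h k = 0"
      using y by (auto simp: yy aff_cartan_explicit)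
    have hg: "mat_bracket n (h 0) g = 0"
      using g h(1) mat_bracket_cartan[OF h(1), of g] by (fastforce simp: cartan_def fun_eq_iff)
    have h0: "mat_bracket n (h 0) 0 = 0"
      by (simp add: mat_bracket_def fun_eq_iff)
    show ?thesis
      using aff_bracket_cartan[OF h so, of p q 0 0] y hg h0
      by (auto simp: prod_eq_iff x yy delta_def aff_scale_def mat_scale_def fun_eq_iff)
  qed
  moreover have "x \<in> affine_alg n"
    using so by (auto simp: x affine_alg_def intro: finite_subset[of _ "{1}"] split: if_splits)
  ultimately show "x \<in> aff_root_space n (delta n)"
    by (auto simp: aff_root_space_def weight_space_def)
qed

end

theory Submission
  imports Defs "HOL-Computational_Algebra.Formal_Power_Series"
begin

text \<open>
  Every basic ideal contains \<open>\<delta>\<close>, hence everything above \<open>\<delta>\<close>, so it is determined by the set \<open>A\<close> of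
  roots \<open>\<gamma> \<in> \<Phi>\<^sup>+\<close> in its support and the set \<open>C\<close> of those \<open>\<gamma> \<in> \<Phi>\<^sup>+\<close> for which \<open>\<delta> - \<gamma>\<close> is not in its
  support. The pairs that occur are the pairs of upper sets of \<open>\<Phi>\<^sup>+\<close> such that no root is a sum of an
  element of \<open>A\<close> and one of \<open>C\<close>; it suffices to exclude the highest root \<open>\<epsilon>\<^sub>n + \<epsilon>\<^sub>n\<^sub>-\<^sub>1\<close> as such a
  sum.

  Arrange \<open>\<Phi>\<^sup>+\<close> as the cells \<open>(i, j)\<close> with \<open>\<bar>j\<bar> < i \<le> n\<close>, where \<open>(i, j)\<close> is the root \<open>\<epsilon>\<^sub>i + \<epsilon>\<^sub>j\<close> with
  \<open>\<epsilon>\<^sub>0 = 0\<close> and \<open>\<epsilon>\<^sub>-\<^sub>j = - \<epsilon>\<^sub>j\<close>. The condition on \<open>(A, C)\<close> then only involves the first cells in the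
  top two rows. If \<open>x\<close> and \<open>y\<close> are the first columns of \<open>A\<close> and \<open>C\<close> in row \<open>n - 1\<close>, there are \<open>(x + y)\<^sup>2\<close>
  choices for row \<open>n\<close> of \<open>A\<close> and \<open>C\<close> when \<open>x + y > 0\<close> and none otherwise, provided that an empty row is given
  the value \<open>n\<close>. With \<open>m = n - 2\<close>, the number of ways to choose the rows of \<open>A\<close> below row \<open>n\<close> is the
  coefficient of \<open>X\<^sup>n\<^sup>-\<^sup>x\<close> in \<open>V = ((1 - X)\<^sup>2 - 2 X\<^sup>m\<^sup>+\<^sup>3 / (1 - X)\<^sup>m\<^sup>+\<^sup>1) / (1 - 2 X)\<close>, and the number of ideals is the
  coefficient of \<open>X\<^sup>2\<^sup>n\<close> in \<open>V\<^sup>2 (\<Sum>k. k\<^sup>2 X\<^sup>k)\<close>.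
\<close>

section \<open>Generating functions\<close>

unbundle fps_syntax

text \<open>The series 1 / (1 - c X). All generating functions below are polynomials in X,
  \<open>geo 1\<close> and \<open>geo 2\<close>.\<close>

definition geo :: "int \<Rightarrow> int fps" where
  "geo c = Abs_fps (\<lambda>k. c ^ k)"

lemma geo_nth [simp]: "geo c $ k = c ^ k"
  by (simp add: geo_def)

lemma geo_inverse: "(1 - fps_const c * fps_X) * geo c = 1"
proof (rule fps_ext)
  fix k show "((1 - fps_const c * fps_X) * geo c) $ k = 1 $ k"
    by (cases k) (simp_all add: algebra_simps)
qed

lemma geo_one: "(1 - fps_X) * geo 1 = 1"
  using geo_inverse[of 1] by simp

lemma geo_two: "(1 - 2 * fps_X) * geo 2 = 1"
  using geo_inverse[of 2] by (simp add: numeral_fps_const)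

lemma geo_two_times_geo_one: "geo 2 * geo 1 = 2 * geo 2 - geo 1"
proof -
  \<comment> \<open>Partial fractions: 2 (1 - X) - (1 - 2 X) = 1, and each summand cancels one of
    the two poles.\<close>
  have "geo 2 * geo 1 = geo 2 * geo 1 * (2 * (1 - fps_X) - (1 - 2 * fps_X))"
    by simp
  also have "\<dots> = 2 * geo 2 * ((1 - fps_X) * geo 1) - geo 1 * ((1 - 2 * fps_X) * geo 2)"
    by (simp add: algebra_simps)
  finally show ?thesis
    by (simp add: geo_one geo_two)
qed

text \<open>Each further factor 1 / (1 - X) forms partial sums, so the hockey-stick identity carries
  the induction.\<close>

lemma geo_one_power_nth: "(geo 1 ^ Suc k) $ m = int ((m + k) choose k)"
proof (induction k arbitrary: m)
  case (Suc k)
  have "(geo 1 ^ Suc (Suc k)) $ m = (geo 1 ^ Suc k * geo 1) $ m"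
    by (simp add: mult.commute)
  also have "\<dots> = (\<Sum>i=0..m. int ((i + k) choose k))"
    unfolding fps_mult_nth Suc by simp
  also have "\<dots> = int (\<Sum>i\<le>m. (k + i) choose i)"
    by (simp add: atMost_atLeast0 binomial_symmetric[of k] add.commute)
  also have "\<dots> = int ((m + Suc k) choose Suc k)"
    unfolding sum_choose_lower by (simp add: binomial_symmetric[of m "Suc (k + m)"] add.commute)
  finally show ?case .
qed simp

section \<open>Truncated binomial sums\<close>

text \<open>The binomial coefficients of row s up to index m minus those beyond m. This difference
  counts upper sets with a bound on the first cell of the top row, see
  \<open>card_threshold_ge\<close>.\<close>

definition row_weight :: "nat \<Rightarrow> nat \<Rightarrow> int" where
  "row_weight m s = 2 * (\<Sum>i\<le>m. int (s choose i)) - 2 ^ s"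

lemma row_weight_0 [simp]: "row_weight m 0 = 1"
  by (simp add: row_weight_def sum.atMost_shift)

lemma row_weight_zero_left: "row_weight 0 s = 2 - 2 ^ s"
  by (simp add: row_weight_def)

lemma row_weight_Suc: "row_weight (Suc m) (Suc s) = row_weight (Suc m) s + row_weight m s"
proof -
  have "(\<Sum>i\<le>Suc m. int (Suc s choose i)) = 1 + (\<Sum>i\<le>m. int (s choose i) + int (s choose Suc i))"
    unfolding sum.atMost_Suc_shift by simp
  also have "\<dots> = (\<Sum>i\<le>Suc m. int (s choose i)) + (\<Sum>i\<le>m. int (s choose i))"
    unfolding sum.distrib sum.atMost_Suc_shift[of _ m] by simp
  finally show ?thesis
    by (simp add: row_weight_def algebra_simps)
qed

text \<open>The two halves of an odd row of Pascal's triangle have equal sums. This is the boundary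
  value that \<open>card_threshold_ge\<close> needs at the left end of a row.\<close>

lemma row_weight_vanishes: "row_weight m (2 * m + 1) = 0"
proof -
  have "(\<Sum>i\<le>m. int ((2 * m + 1) choose i)) = int (2 ^ (2 * m))"
    unfolding of_nat_sum[symmetric] binomial_r_part_sum ..
  then show ?thesis
    by (simp add: row_weight_def)
qed

text \<open>The binomial coefficients beyond index m have the generating function X^(m+1) / ((1 - 2
  X) (1 - X)^(m+1)), and twice this is subtracted from that of 2^s. Pascal's rule gives the
  induction on m.\<close>

lemma row_weight_fps:
  "Abs_fps (row_weight m) = geo 2 - 2 * fps_X ^ Suc m * (geo 2 * geo 1 ^ Suc m)"
proof (induction m)
  case 0
  have "Abs_fps (row_weight 0) = 2 * geo 1 - geo 2"
    by (rule fps_ext) (simp add: row_weight_zero_left numeral_fps_const)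
  also have "\<dots> = geo 2 - 2 * geo 2 + 2 * geo 1 * ((1 - 2 * fps_X) * geo 2)"
    unfolding geo_two by simp
  also have "\<dots> = geo 2 - 2 * geo 2 + 2 * geo 2 * ((1 - fps_X) * geo 1) - 2 * fps_X * (geo 2 * geo 1)"
    by (simp add: algebra_simps)
  finally show ?case
    unfolding geo_one by simp
next
  case (Suc m)
  have "(1 - fps_X) * Abs_fps (row_weight (Suc m)) = 1 + fps_X * Abs_fps (row_weight m)"
  proof (rule fps_ext)
    fix k show "((1 - fps_X) * Abs_fps (row_weight (Suc m))) $ k
      = (1 + fps_X * Abs_fps (row_weight m)) $ k"
      by (cases k) (simp_all add: algebra_simps row_weight_Suc)
  qed
  then have "Abs_fps (row_weight (Suc m)) * ((1 - fps_X) * geo 1)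
      = (1 + fps_X * Abs_fps (row_weight m)) * geo 1"
    by (metis mult.assoc mult.commute)
  then have "Abs_fps (row_weight (Suc m)) = (1 + fps_X * Abs_fps (row_weight m)) * geo 1"
    unfolding geo_one by simp
  also have "\<dots> = (1 + fps_X * geo 2) * geo 1 - 2 * fps_X ^ Suc (Suc m) * (geo 2 * geo 1 ^ Suc (Suc m))"
    unfolding Suc by (simp add: algebra_simps)
  also have "(1 + fps_X * geo 2) * geo 1 = ((1 - 2 * fps_X) * geo 2 + fps_X * geo 2) * geo 1"
    unfolding geo_two ..
  also have "\<dots> = geo 2 * ((1 - fps_X) * geo 1)"
    by (simp add: algebra_simps)
  finally show ?case
    unfolding geo_one by simp
qed

section \<open>Central coefficients\<close>

text \<open>Obtained from the coefficient of X^(2m+1) in \<open>row_weight_fps\<close>, where the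
  left side vanishes; the factor X^(m+1) shifts the index to m.\<close>

lemma central_coeff_1: "(geo 2 * geo 1 ^ Suc m) $ m = 4 ^ m"
proof -
  have "2 * fps_X ^ Suc m * (geo 2 * geo 1 ^ Suc m)
      = fps_const 2 * (fps_X ^ Suc m * (geo 2 * geo 1 ^ Suc m))"
    by (simp only: numeral_fps_const mult.assoc)
  then have "row_weight m (2 * m + 1) = (geo 2 - fps_const 2 * (fps_X ^ Suc m * (geo 2 * geo 1 ^ Suc m))) $ (2 * m + 1)"
    by (metis row_weight_fps fps_nth_Abs_fps)
  also have "\<dots> = 2 ^ (2 * m + 1) - 2 * (geo 2 * geo 1 ^ Suc m) $ m"
    unfolding fps_sub_nth fps_mult_left_const_nth fps_X_power_mult_nth by (simp del: power_Suc)
  finally show ?thesis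
    unfolding row_weight_vanishes by (simp add: power_mult)
qed

lemma two_times_fps_nth: "(2 * f :: int fps) $ k = 2 * f $ k"
  by (simp add: numeral_fps_const)

text \<open>A partial fraction step that removes one factor 1 / (1 - X). Starting from
  \<open>central_coeff_1\<close> it gives the coefficients for the neighbouring exponents m and m +
  2.\<close>

lemma geo_power_reduce:
  "geo 2 * geo 1 ^ Suc k = 2 * (geo 2 * geo 1 ^ k) - geo 1 ^ Suc k"
proof -
  have "geo 2 * geo 1 ^ Suc k = (geo 2 * geo 1) * geo 1 ^ k"
    by (simp add: algebra_simps)
  then show ?thesis
    unfolding geo_two_times_geo_one by (simp add: algebra_simps)
qed

lemma geo_square_power_reduce:
  "geo 2 * geo 2 * geo 1 ^ Suc k = 2 * (geo 2 * geo 2 * geo 1 ^ k) - geo 2 * geo 1 ^ Suc k"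
proof -
  have "geo 2 * geo 2 * geo 1 ^ Suc k = geo 2 * (geo 2 * geo 1 ^ Suc k)"
    by (simp add: algebra_simps)
  also have "\<dots> = geo 2 * (2 * (geo 2 * geo 1 ^ k) - geo 1 ^ Suc k)"
    unfolding geo_power_reduce ..
  finally show ?thesis
    by (simp add: algebra_simps)
qed

lemma central_coeff_0: "2 * (geo 2 * geo 1 ^ m) $ m = 4 ^ m + int ((2 * m) choose m)"
proof -
  have "(geo 2 * geo 1 ^ Suc m) $ m = 2 * (geo 2 * geo 1 ^ m) $ m - int ((m + m) choose m)"
    unfolding geo_power_reduce fps_sub_nth two_times_fps_nth geo_one_power_nth ..
  then show ?thesis
    unfolding central_coeff_1 by (simp flip: mult_2)
qed

lemma central_coeff_2: "(geo 2 * geo 1 ^ Suc (Suc m)) $ m = 2 * 4 ^ m - int ((2 * m + 1) choose m)"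
proof -
  have "(m + Suc m) choose Suc m = (2 * m + 1) choose m"
    using binomial_symmetric[of m "2 * m + 1"] by (simp flip: mult_2)
  then show ?thesis
    unfolding geo_power_reduce[of "Suc m"] fps_sub_nth two_times_fps_nth central_coeff_1 geo_one_power_nth
    by simp
qed

lemma fps_X_geo_two: "2 * fps_X * geo 2 = geo 2 - 1"
  using geo_two by (simp add: algebra_simps)

lemma fps_X_geo_one: "fps_X * geo 1 = geo 1 - 1"
  using geo_one by (simp add: algebra_simps)

lemma fps_deriv_geo_two: "fps_deriv (geo 2) = 2 * (geo 2 * geo 2)"
proof -
  have "fps_deriv ((1 - fps_const 2 * fps_X) * geo 2) = 0"
    unfolding geo_inverse by simp
  then have "(1 - 2 * fps_X) * fps_deriv (geo 2) = 2 * geo 2"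
    by (simp add: algebra_simps numeral_fps_const)
  then have "((1 - 2 * fps_X) * geo 2) * fps_deriv (geo 2) = 2 * (geo 2 * geo 2)"
    by (simp only: mult_ac)
  then show ?thesis
    by (simp add: geo_two)
qed

lemma fps_deriv_geo_one: "fps_deriv (geo 1) = geo 1 * geo 1"
proof -
  have "fps_deriv ((1 - fps_const 1 * fps_X) * geo 1) = 0"
    unfolding geo_inverse by simp
  then have "(1 - fps_X) * fps_deriv (geo 1) = geo 1"
    by (simp add: algebra_simps)
  then have "((1 - fps_X) * geo 1) * fps_deriv (geo 1) = geo 1 * geo 1"
    by (simp only: mult_ac)
  then show ?thesis
    by (simp add: geo_one)
qed

lemma fps_deriv_geo_one_power: "fps_deriv (geo 1 ^ k) = of_nat k * geo 1 ^ Suc k"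
  by (induction k) (simp_all add: fps_deriv_geo_one algebra_simps)

lemma fps_X_times_deriv_nth: "(fps_X * fps_deriv f) $ k = of_nat k * f $ k"
  by (cases k) simp_all

text \<open>Comparing coefficients in \<open>X F'\<close> for \<open>F = 1 / ((1 - 2 X) (1 - X)\<^sup>m)\<close> reduces the double pole
  at \<open>1/2\<close> to a simple one.\<close>

lemma central_coeff_double: "(geo 2 * geo 2 * geo 1 ^ Suc m) $ m = (2 * int m + 1) * int ((2 * m) choose m)"
proof -
  let ?F = "geo 2 * geo 1 ^ m"
  have "fps_X * fps_deriv ?F
      = (2 * fps_X * geo 2) * (geo 2 * geo 1 ^ m) + of_nat m * (fps_X * geo 1) * (geo 2 * geo 1 ^ m)"
    by (simp add: fps_deriv_geo_two fps_deriv_geo_one_power algebra_simps)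
  also have "\<dots> = geo 2 * geo 2 * geo 1 ^ m - ?F + of_nat m * (geo 2 * geo 1 ^ Suc m - ?F)"
    unfolding fps_X_geo_two fps_X_geo_one by (simp add: algebra_simps)
  finally have "(fps_X * fps_deriv ?F) $ m
      = (geo 2 * geo 2 * geo 1 ^ m) $ m - ?F $ m + int m * ((geo 2 * geo 1 ^ Suc m) $ m - ?F $ m)"
    unfolding fps_of_nat[symmetric] fps_add_nth fps_sub_nth fps_mult_left_const_nth by simp
  then have "(geo 2 * geo 2 * geo 1 ^ m) $ m = (2 * int m + 1) * ?F $ m - int m * 4 ^ m"
    unfolding central_coeff_1 fps_X_times_deriv_nth by (simp add: algebra_simps)
  then have "(geo 2 * geo 2 * geo 1 ^ Suc m) $ m
      = (2 * int m + 1) * (2 * ?F $ m) - 2 * int m * 4 ^ m - 4 ^ m"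
    unfolding geo_square_power_reduce fps_sub_nth two_times_fps_nth central_coeff_1
    by (simp add: algebra_simps)
  then show ?thesis
    unfolding central_coeff_0 by (simp add: algebra_simps)
qed

text \<open>This is the cross term of the square in \<open>weighted_sum_closed\<close>. Writing 1 +
  X = 2 - (1 - X) cancels one factor 1 / (1 - X), after which \<open>central_coeff_double\<close>
  and \<open>central_coeff_2\<close> apply.\<close>

lemma central_coeff_correction:
  "((1 + fps_X) * (geo 2 * geo 2 * geo 1 ^ (m + 2))) $ m
    = (3 * int m + 5) * int ((2 * m + 1) choose m) - 4 * 4 ^ m"
proof -
  have "(1 + fps_X) * (geo 2 * geo 2 * geo 1 ^ Suc (Suc m))
      = 2 * (geo 2 * geo 2 * geo 1 ^ Suc (Suc m)) - (geo 2 * geo 2 * geo 1 ^ Suc m) * ((1 - fps_X) * geo 1)"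
    by (simp add: algebra_simps)
  also have "\<dots> = 2 * (geo 2 * geo 2 * geo 1 ^ Suc (Suc m)) - geo 2 * geo 2 * geo 1 ^ Suc m"
    unfolding geo_one by simp
  also have "\<dots> $ m = 3 * (geo 2 * geo 2 * geo 1 ^ Suc m) $ m - 2 * (geo 2 * geo 1 ^ Suc (Suc m)) $ m"
    unfolding geo_square_power_reduce[of "Suc m"] fps_sub_nth two_times_fps_nth by simp
  also have "\<dots> = 3 * ((2 * int m + 1) * int ((2 * m) choose m)) - 4 * 4 ^ m + 2 * int ((2 * m + 1) choose m)"
    unfolding central_coeff_double central_coeff_2 by simp
  also have "(2 * int m + 1) * int ((2 * m) choose m) = (int m + 1) * int ((2 * m + 1) choose m)"
  proof -
    have "Suc m * (Suc (2 * m) choose Suc m) = Suc (2 * m) * ((2 * m) choose m)"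
      using Suc_times_binomial_eq[of "2 * m" m] by (simp only: mult.commute)
    moreover have "Suc (2 * m) choose Suc m = (2 * m + 1) choose m"
      using binomial_symmetric[of m "2 * m + 1"] by simp
    ultimately have "(m + 1) * ((2 * m + 1) choose m) = (2 * m + 1) * ((2 * m) choose m)"
      by simp
    then show ?thesis
      by (metis (mono_tags) of_nat_1 of_nat_add of_nat_mult of_nat_numeral)
  qed
  finally show ?thesis
    by (simp add: algebra_simps)
qed

section \<open>The final generating function\<close>

text \<open>Here s is the distance of the threshold of row m + 1 from m + 2, its value on the empty
  set. So s = 0 is the empty set, and s = 1 would be column m + 1, which is outside the row.\<close>

definition padded_weight :: "nat \<Rightarrow> nat \<Rightarrow> int" where
  "padded_weight m s = (if s = 0 then 1 else if s = 1 then 0 else row_weight m (s - 2))"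

lemma padded_weight_fps: "Abs_fps (padded_weight m) = 1 + fps_X ^ 2 * Abs_fps (row_weight m)"
proof (rule fps_ext)
  fix s :: nat
  consider "s = 0" | "s = 1" | "s \<ge> 2" by linarith
  then show "Abs_fps (padded_weight m) $ s = (1 + fps_X ^ 2 * Abs_fps (row_weight m)) $ s"
    by cases (auto simp: padded_weight_def fps_X_power_mult_nth)
qed

definition squares :: "int fps" where
  "squares = Abs_fps (\<lambda>k. (int k)\<^sup>2)"

lemma squares_eq: "squares = fps_X * (1 + fps_X) * geo 1 ^ 3"
proof -
  have "(fps_X * (1 + fps_X) * geo 1 ^ 3) $ k = squares $ k" for k
  proof -
    \<comment> \<open>Doubled, so that the triangular numbers need no division.\<close>
    have c: "2 * (geo 1 ^ 3) $ j = (int j + 1) * (int j + 2)" for j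
    proof -
      have "Suc 1 * (Suc (j + 1) choose Suc 1) = Suc (j + 1) * ((j + 1) choose 1)"
        by (rule Suc_times_binomial)
      then have "int (2 * ((j + 2) choose 2)) = int ((j + 2) * (j + 1))"
        by (simp add: numeral_2_eq_2 del: binomial_Suc_Suc of_nat_mult mult_Suc mult_Suc_right)
      then show ?thesis
        using geo_one_power_nth[of 2 j] by (simp add: numeral_3_eq_3 algebra_simps)
    qed
    have "(fps_X * (1 + fps_X) * geo 1 ^ 3) $ k = (fps_X * geo 1 ^ 3 + fps_X ^ 2 * geo 1 ^ 3) $ k"
      by (simp add: algebra_simps power2_eq_square)
    also have "\<dots> = (if k = 0 then 0 else (geo 1 ^ 3) $ (k - 1)) + (if k < 2 then 0 else (geo 1 ^ 3) $ (k - 2))"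
      by (simp add: fps_X_power_mult_nth)
    also have "\<dots> = (int k)\<^sup>2"
    proof (cases "k < 2")
      case True
      then have "k = 0 \<or> k = 1" by linarith
      moreover have "(geo 1 ^ 3) $ 0 = 1"
        by (simp add: fps_power_zeroth)
      ultimately show ?thesis by auto
    next
      case False
      then have k: "k = Suc (Suc (k - 2))" by simp
      then obtain j where j: "k = Suc (Suc j)" by blast
      have "2 * ((geo 1 ^ 3) $ Suc j + (geo 1 ^ 3) $ j) = 2 * (int k)\<^sup>2"
        unfolding distrib_left c j by (simp add: power2_eq_square algebra_simps)
      then show ?thesis
        unfolding j by simp
    qed
    finally show ?thesis by (simp add: squares_def)
  qed
  then show ?thesis
    by (intro fps_ext) simp
qed

text \<open>With 1 written as (1 - 2 X) / (1 - 2 X), the numerator collects 1 - 2 X + X^2 = (1 -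
  X)^2.\<close>

lemma padded_weight_closed:
  "Abs_fps (padded_weight m) = geo 2 * ((1 - fps_X) ^ 2 - 2 * fps_X ^ (m + 3) * geo 1 ^ (m + 1))"
proof -
  have "Abs_fps (padded_weight m)
      = (1 - 2 * fps_X) * geo 2 + fps_X ^ 2 * (geo 2 - 2 * fps_X ^ Suc m * (geo 2 * geo 1 ^ Suc m))"
    unfolding padded_weight_fps row_weight_fps geo_two ..
  also have "\<dots> = geo 2 * ((1 - fps_X) ^ 2 - 2 * fps_X ^ (m + 3) * geo 1 ^ (m + 1))"
    by (simp add: algebra_simps power2_eq_square power3_eq_cube power_add)
  finally show ?thesis .
qed

text \<open>Stated for arbitrary series, so that only ring arithmetic is left: \<open>b\<close> is 1
  - X, \<open>B\<close> its inverse, \<open>A\<close> is 1 / (1 - 2 X), \<open>P\<close> is X^(m+3),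
  and \<open>E\<close> is 1 / (1 - X)^(m+1). The result is sorted by powers of
  \<open>P\<close>.\<close>

lemma ring_square_expand:
  fixes A b X B P E :: "int fps"
  assumes "b * B = 1"
  shows "X * (1 + X) * B ^ 3 * (A * (b ^ 2 - 2 * P * E)) ^ 2
    = A * A * (X * (1 + X) * b) - 4 * (P * X * ((1 + X) * (A * A * (E * B)))) +
        P * (P * (4 * X * (1 + X) * B ^ 3 * A ^ 2 * E ^ 2))"
proof -
  have "X * (1 + X) * B ^ 3 * (A * (b ^ 2 - 2 * P * E)) ^ 2
    = A * A * (X * (1 + X) * ((b * B) ^ 3 * b)) - 4 * (P * X * ((1 + X) * (A * A * (E * ((b * B) ^ 2 * B))))) +
        P * (P * (4 * X * (1 + X) * B ^ 3 * A ^ 2 * E ^ 2))"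
    by (simp add: power2_eq_square power3_eq_cube algebra_simps)
  then show ?thesis
    unfolding assms by simp
qed

lemma weighted_sum_closed:
  "(squares * Abs_fps (padded_weight m) * Abs_fps (padded_weight m)) $ (2 * m + 4)
    = (3 * int m + 11) * 2 ^ (2 * m + 2) - 2 * (3 * int m + 5) * int ((2 * m + 2) choose (m + 1))"
proof -
  let ?N = "2 * m + 4"
  let ?R = "4 * fps_X * (1 + fps_X) * geo 1 ^ 3 * geo 2 ^ 2 * (geo 1 ^ (m + 1)) ^ 2"
  let ?M = "geo 2 * geo 2 * geo 1 ^ (m + 2)"
  have "squares * Abs_fps (padded_weight m) * Abs_fps (padded_weight m)
     = fps_X * (1 + fps_X) * geo 1 ^ 3 * (geo 2 * ((1 - fps_X) ^ 2 - 2 * fps_X ^ (m + 3) * geo 1 ^ (m + 1))) ^ 2"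
    unfolding squares_eq padded_weight_closed by (simp add: power2_eq_square mult.assoc)
  also have "\<dots> = geo 2 * geo 2 * (fps_X * (1 + fps_X) * (1 - fps_X))
      - 4 * (fps_X ^ (m + 3) * fps_X * ((1 + fps_X) * (geo 2 * geo 2 * (geo 1 ^ (m + 1) * geo 1))))
      + fps_X ^ (m + 3) * (fps_X ^ (m + 3) * ?R)"
    by (rule ring_square_expand[OF geo_one])
  also have "\<dots> = geo 2 * geo 2 * (fps_X * (1 + fps_X) * (1 - fps_X))
      - fps_const 4 * (fps_X ^ (m + 4) * ((1 + fps_X) * ?M)) + fps_X ^ (2 * m + 6) * ?R"
  proof -
    have "fps_X ^ (m + 3) * (fps_X ^ (m + 3) * ?R) = fps_X ^ (2 * m + 6) * ?R"
    proof -
      have "2 * m + 6 = (m + 3) + (m + 3)" by simp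
      then show ?thesis
        by (simp only: power_add mult.assoc)
    qed
    moreover have "fps_X ^ (m + 3) * fps_X = (fps_X :: int fps) ^ (m + 4)"
      by (simp add: eval_nat_numeral)
    moreover have "geo 1 ^ (m + 1) * geo 1 = geo 1 ^ (m + 2)"
      by simp
    ultimately show ?thesis
      by (simp only: numeral_fps_const)
  qed
  \<comment> \<open>The term with X^(2m+6) does not reach degree 2 m + 4, and X^(m+4) shifts the
    index of the cross term to m.\<close>
  finally have "(squares * Abs_fps (padded_weight m) * Abs_fps (padded_weight m)) $ ?N
      = (geo 2 * geo 2 * (fps_X * (1 + fps_X) * (1 - fps_X))) $ ?N - 4 * ((1 + fps_X) * ?M) $ m"
  proof -
    assume eq: "squares * Abs_fps (padded_weight m) * Abs_fps (padded_weight m)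
      = geo 2 * geo 2 * (fps_X * (1 + fps_X) * (1 - fps_X))
      - fps_const 4 * (fps_X ^ (m + 4) * ((1 + fps_X) * ?M)) + fps_X ^ (2 * m + 6) * ?R"
    have "(fps_X ^ (2 * m + 6) * ?R) $ ?N = 0"
      unfolding fps_X_power_mult_nth by simp
    moreover have "(fps_X ^ (m + 4) * ((1 + fps_X) * ?M)) $ ?N = ((1 + fps_X) * ?M) $ m"
      unfolding fps_X_power_mult_nth by simp
    ultimately show ?thesis
      unfolding eq fps_add_nth fps_sub_nth fps_mult_left_const_nth by simp
  qed
  moreover have "(geo 2 * geo 2 * (fps_X * (1 + fps_X) * (1 - fps_X))) $ ?N = (3 * int m + 7) * 2 ^ (2 * m + 2)"
  proof -
    have g: "(geo 2 * geo 2) $ k = (int k + 1) * 2 ^ k" for k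
    proof -
      \<comment> \<open>The double pole is half the derivative of the simple one.\<close>
      have "2 * (geo 2 * geo 2) $ k = fps_deriv (geo 2) $ k"
        unfolding fps_deriv_geo_two two_times_fps_nth ..
      then show ?thesis by simp
    qed
    have "geo 2 * geo 2 * (fps_X * (1 + fps_X) * (1 - fps_X))
        = fps_X ^ 1 * (geo 2 * geo 2) - fps_X ^ 3 * (geo 2 * geo 2)"
      by (simp add: algebra_simps power3_eq_cube)
    then show ?thesis
      unfolding fps_sub_nth fps_X_power_mult_nth
      by (simp add: g fps_X_power_mult_nth eval_nat_numeral algebra_simps)
  qed
  moreover have "(2 * m + 2) choose (m + 1) = 2 * ((2 * m + 1) choose m)"
    using binomial_symmetric[of m "2 * m + 1"] by simp
  then have "int ((2 * m + 2) choose (m + 1)) = 2 * int ((2 * m + 1) choose m)"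
    by simp
  moreover have "(2 :: int) ^ (2 * m + 2) = 4 * 4 ^ m"
    by (simp add: power_mult)
  ultimately show ?thesis
    unfolding central_coeff_correction by (simp add: ring_distribs)
qed

section \<open>Pairs of commuting upper sets\<close>

definition cells :: "nat \<Rightarrow> (int \<times> int) set" where
  "cells m = {(i, j). 1 \<le> i \<and> i \<le> int m \<and> \<bar>j\<bar> < i}"

text \<open>With (i, j) read as the root \<epsilon>_i + \<epsilon>_j, the componentwise order of
  cells is the root order.\<close>

definition upper_sets :: "nat \<Rightarrow> (int \<times> int) set set" where
  "upper_sets m = {X. X \<subseteq> cells m \<and>
     (\<forall>i j i' j'. (i, j) \<in> X \<longrightarrow> i \<le> i' \<longrightarrow> i' \<le> int m \<longrightarrow> j \<le> j' \<longrightarrow> j' < i' \<longrightarrow> (i', j') \<in> X)}"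

text \<open>An empty row gets m + 1 rather than m. Then row m + 1 may start anywhere from column -m
  up to the threshold, whether row m is empty or not, a start at m + 1 meaning that row m + 1 is
  empty.\<close>

definition threshold :: "nat \<Rightarrow> (int \<times> int) set \<Rightarrow> int" where
  "threshold m X = (if \<exists>j. (int m, j) \<in> X then Min {j. (int m, j) \<in> X} else int m + 1)"

definition add_row :: "nat \<Rightarrow> (int \<times> int) set \<Rightarrow> int \<Rightarrow> (int \<times> int) set" where
  "add_row m X t = X \<union> {(int m + 1, j) |j. t \<le> j \<and> j < int m + 1}"

lemma finite_cells: "finite (cells m)"
proof (rule finite_subset)
  show "cells m \<subseteq> {1..int m} \<times> {- int m..int m}"
    by (auto simp: cells_def)
qed simp

lemma finite_upper_sets: "finite (upper_sets m)"
  by (rule finite_subset[of _ "Pow (cells m)"]) (auto simp: upper_sets_def finite_cells)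

lemma upper_sets_cells: "X \<in> upper_sets m \<Longrightarrow> (i, j) \<in> X \<Longrightarrow> 1 \<le> i \<and> i \<le> int m \<and> \<bar>j\<bar> < i"
  by (auto simp: upper_sets_def cells_def)

lemma upper_setsD:
  "X \<in> upper_sets m \<Longrightarrow> (i, j) \<in> X \<Longrightarrow> i \<le> i' \<Longrightarrow> i' \<le> int m \<Longrightarrow> j \<le> j' \<Longrightarrow> j' < i' \<Longrightarrow> (i', j') \<in> X"
  unfolding upper_sets_def by blast

lemma empty_upper_set: "{} \<in> upper_sets m"
  by (simp add: upper_sets_def)

lemma threshold_props:
  assumes X: "X \<in> upper_sets m" and ne: "(int m, k) \<in> X"
  shows "(int m, threshold m X) \<in> X" "\<And>j. (int m, j) \<in> X \<Longrightarrow> threshold m X \<le> j"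
proof -
  let ?R = "{j. (int m, j) \<in> X}"
  have "?R \<subseteq> {- int m..int m}"
  proof
    fix j assume "j \<in> ?R"
    then have "(int m, j) \<in> X" by simp
    from upper_sets_cells[OF X this] show "j \<in> {- int m..int m}" by auto
  qed
  then have "finite ?R"
    by (rule finite_subset) simp
  moreover have "?R \<noteq> {}" "threshold m X = Min ?R"
    using ne by (auto simp: threshold_def)
  ultimately show "(int m, threshold m X) \<in> X" "\<And>j. (int m, j) \<in> X \<Longrightarrow> threshold m X \<le> j"
    using Min_in[of ?R] Min_le[of ?R] by auto
qed

lemma threshold_iff:
  assumes "X \<in> upper_sets m"
  shows "(int m, j) \<in> X \<longleftrightarrow> threshold m X \<le> j \<and> j < int m"
proof
  assume "(int m, j) \<in> X"
  then show "threshold m X \<le> j \<and> j < int m"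
    using threshold_props[OF assms] upper_sets_cells[OF assms, of "int m" j] by auto
next
  assume *: "threshold m X \<le> j \<and> j < int m"
  then obtain k where "(int m, k) \<in> X"
    by (auto simp: threshold_def split: if_splits)
  then have "(int m, threshold m X) \<in> X"
    by (rule threshold_props[OF assms])
  then show "(int m, j) \<in> X"
    using * upper_setsD[OF assms] by blast
qed

text \<open>A nonempty upper set meets the top row, because each of its cells can be moved to row m
  within its column.\<close>

lemma threshold_bounds:
  assumes "X \<in> upper_sets m"
  shows "threshold m X = int m + 1 \<and> X = {} \<or> - int m < threshold m X \<and> threshold m X < int m"
proof (cases "\<exists>j. (int m, j) \<in> X")
  case True
  then obtain k where "(int m, k) \<in> X" by blast
  then have "(int m, threshold m X) \<in> X"
    by (rule threshold_props[OF assms])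
  then show ?thesis
    using upper_sets_cells[OF assms, of "int m" "threshold m X"] by auto
next
  case False
  have "(i, j) \<notin> X" for i j
  proof
    assume ij: "(i, j) \<in> X"
    then have "(int m, j) \<in> X"
      using upper_sets_cells[OF assms ij] by (intro upper_setsD[OF assms ij]) auto
    with False show False by blast
  qed
  then show ?thesis
    using False by (auto simp: threshold_def)
qed

lemma threshold_empty: "threshold m {} = int m + 1"
  by (simp add: threshold_def)

lemma threshold_eq_empty: "X \<in> upper_sets m \<Longrightarrow> threshold m X = int m + 1 \<longleftrightarrow> X = {}"
  using threshold_bounds[of X m] threshold_empty[of m] by fastforce

lemma add_row_upper:
  assumes X: "X \<in> upper_sets m" and t: "- int m \<le> t" "t \<le> threshold m X"
  shows "add_row m X t \<in> upper_sets (Suc m)"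
  unfolding upper_sets_def
proof (intro CollectI conjI allI impI)
  show "add_row m X t \<subseteq> cells (Suc m)"
    using t by (auto simp: add_row_def cells_def dest: upper_sets_cells[OF X])
next
  fix i j i' j'
  assume ij: "(i, j) \<in> add_row m X t" and le: "i \<le> i'" "i' \<le> int (Suc m)" "j \<le> j'" "j' < i'"
  show "(i', j') \<in> add_row m X t"
  proof (cases "(i, j) \<in> X")
    case True
    show ?thesis
    proof (cases "i' = int m + 1")
      case True
      have "(int m, j) \<in> X"
        using upper_sets_cells[OF X \<open>(i, j) \<in> X\<close>] by (intro upper_setsD[OF X \<open>(i, j) \<in> X\<close>]) auto
      then have "t \<le> j'"
        using threshold_iff[OF X] t le by auto
      then show ?thesis
        using True le by (auto simp: add_row_def)
    next
      case False
      then have "(i', j') \<in> X"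
        using le by (intro upper_setsD[OF X True]) auto
      then show ?thesis
        by (simp add: add_row_def)
    qed
  next
    case False
    then show ?thesis
      using ij le by (auto simp: add_row_def)
  qed
qed

lemma add_row_restrict: "X \<in> upper_sets m \<Longrightarrow> add_row m X t \<inter> cells m = X"
  by (auto simp: add_row_def cells_def dest: upper_sets_cells)

lemma add_row_top: "X \<in> upper_sets m \<Longrightarrow> (int m + 1, j) \<in> add_row m X t \<longleftrightarrow> t \<le> j \<and> j < int m + 1"
  by (auto simp: add_row_def dest: upper_sets_cells)

lemma restrict_upper: "Y \<in> upper_sets (Suc m) \<Longrightarrow> Y \<inter> cells m \<in> upper_sets m"
  unfolding upper_sets_def cells_def by auto

text \<open>Column m + 1 lies outside row m + 1, so t = m + 1 leaves the new row empty and its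
  default value is m + 2.\<close>

lemma threshold_add_row:
  assumes "X \<in> upper_sets m" "- int m \<le> t" "t \<le> threshold m X"
  shows "threshold (Suc m) (add_row m X t) = (if t = int m + 1 then int m + 2 else t)"
proof -
  have Y: "add_row m X t \<in> upper_sets (Suc m)"
    using assms by (rule add_row_upper)
  have top: "threshold (Suc m) (add_row m X t) \<le> j \<and> j < int m + 1 \<longleftrightarrow> t \<le> j \<and> j < int m + 1" for j
    using threshold_iff[OF Y, of j] add_row_top[OF assms(1), of j t] by (simp add: add.commute)
  have "t \<le> int m + 1"
    using assms(3) threshold_bounds[OF assms(1)] by auto
  then show ?thesis
    using top[of t] top[of "threshold (Suc m) (add_row m X t)"] threshold_bounds[OF Y] by auto
qed

text \<open>The inverse cuts off the top row and reads its first column, turning the default m + 2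
  back into m + 1.\<close>

lemma bij_add_row:
  "bij_betw (\<lambda>(X, t). add_row m X t) (SIGMA X:upper_sets m. {- int m..threshold m X}) (upper_sets (Suc m))"
proof (rule bij_betw_byWitness
    [where f' = "\<lambda>Y. (Y \<inter> cells m, if threshold (Suc m) Y = int m + 2 then int m + 1 else threshold (Suc m) Y)"])
  let ?back = "\<lambda>Y. (Y \<inter> cells m, if threshold (Suc m) Y = int m + 2 then int m + 1 else threshold (Suc m) Y)"
  show "\<forall>a\<in>SIGMA X:upper_sets m. {- int m..threshold m X}. ?back (case a of (X, t) \<Rightarrow> add_row m X t) = a"
  proof
    fix a assume "a \<in> (SIGMA X:upper_sets m. {- int m..threshold m X})"
    then obtain X t where a: "a = (X, t)" "X \<in> upper_sets m" "- int m \<le> t" "t \<le> threshold m X"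
      by auto
    moreover have "t \<le> int m + 1"
      using a threshold_bounds[OF a(2)] by auto
    ultimately show "?back (case a of (X, t) \<Rightarrow> add_row m X t) = a"
      by (auto simp: add_row_restrict threshold_add_row)
  qed
  let ?t = "\<lambda>Y. if threshold (Suc m) Y = int m + 2 then int m + 1 else threshold (Suc m) Y"
  have bound: "- int m \<le> ?t Y \<and> ?t Y \<le> threshold m (Y \<inter> cells m)" if Y: "Y \<in> upper_sets (Suc m)" for Y
  proof -
    note X = restrict_upper[OF Y]
    have "?t Y \<le> threshold m (Y \<inter> cells m)"
    proof (cases "Y \<inter> cells m = {}")
      case True
      then show ?thesis
        unfolding True threshold_empty using threshold_bounds[OF Y] by auto
    next
      case False
      then have b: "threshold m (Y \<inter> cells m) < int m"
        using threshold_bounds[OF X] by auto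
      then have *: "(int m, threshold m (Y \<inter> cells m)) \<in> Y"
        using threshold_iff[OF X, of "threshold m (Y \<inter> cells m)"] b by simp
      have "(int (Suc m), threshold m (Y \<inter> cells m)) \<in> Y"
        using b by (intro upper_setsD[OF Y *]) auto
      then show ?thesis
        unfolding threshold_iff[OF Y] using b by auto
    qed
    then show ?thesis
      using threshold_bounds[OF Y] by auto
  qed
  show "(\<lambda>Y. (Y \<inter> cells m, ?t Y)) ` upper_sets (Suc m) \<subseteq> (SIGMA X:upper_sets m. {- int m..threshold m X})"
    using bound restrict_upper by auto
  show "(\<lambda>(X, t). add_row m X t) ` (SIGMA X:upper_sets m. {- int m..threshold m X}) \<subseteq> upper_sets (Suc m)"
    by (auto intro: add_row_upper)
  show "\<forall>Y\<in>upper_sets (Suc m). (case (Y \<inter> cells m, ?t Y) of (X, t) \<Rightarrow> add_row m X t) = Y"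
  proof
    fix Y assume Y: "Y \<in> upper_sets (Suc m)"
    have "(i, j) \<in> add_row m (Y \<inter> cells m) (?t Y) \<longleftrightarrow> (i, j) \<in> Y" for i j
    proof (cases "i = int m + 1")
      case True
      have "(i, j) \<in> add_row m (Y \<inter> cells m) (?t Y) \<longleftrightarrow> ?t Y \<le> j \<and> j < int m + 1"
        unfolding True by (rule add_row_top[OF restrict_upper[OF Y]])
      moreover have "(i, j) \<in> Y \<longleftrightarrow> threshold (Suc m) Y \<le> j \<and> j < int m + 1"
        using threshold_iff[OF Y, of j] True by (simp add: add.commute)
      ultimately show ?thesis by auto
    next
      case False
      then show ?thesis
        using upper_sets_cells[OF Y, of i j] by (auto simp: add_row_def cells_def)
    qed
    then show "(case (Y \<inter> cells m, ?t Y) of (X, t) \<Rightarrow> add_row m X t) = Y"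
      by auto
  qed
qed

lemma add_row_cases:
  assumes "Y \<in> upper_sets (Suc m)"
  obtains X t where "Y = add_row m X t" "X \<in> upper_sets m" "- int m \<le> t" "t \<le> threshold m X"
proof -
  have "Y \<in> (\<lambda>(X, t). add_row m X t) ` (SIGMA X:upper_sets m. {- int m..threshold m X})"
    using assms bij_betw_imp_surj_on[OF bij_add_row] by metis
  with that show ?thesis by auto
qed

section \<open>Counting upper sets by threshold\<close>

text \<open>Once the nonempty top row is fixed, only the rows below it are free, and their threshold
  must not lie to the left of t.\<close>

lemma card_threshold_eq:
  assumes "- int m \<le> t" "t \<le> int m"
  shows "card {Y \<in> upper_sets (Suc m). threshold (Suc m) Y = t} = card {X \<in> upper_sets m. t \<le> threshold m X}"
proof -
  have "bij_betw (\<lambda>X. add_row m X t) {X \<in> upper_sets m. t \<le> threshold m X}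
      {Y \<in> upper_sets (Suc m). threshold (Suc m) Y = t}"
  proof (rule bij_betwI')
    fix X X' assume "X \<in> {X \<in> upper_sets m. t \<le> threshold m X}" "X' \<in> {X \<in> upper_sets m. t \<le> threshold m X}"
    then show "(add_row m X t = add_row m X' t) = (X = X')"
      using add_row_restrict[of X m t] add_row_restrict[of X' m t] by auto
  next
    fix X assume "X \<in> {X \<in> upper_sets m. t \<le> threshold m X}"
    then show "add_row m X t \<in> {Y \<in> upper_sets (Suc m). threshold (Suc m) Y = t}"
      using assms add_row_upper threshold_add_row by auto
  next
    fix Y assume Y: "Y \<in> {Y \<in> upper_sets (Suc m). threshold (Suc m) Y = t}"
    then obtain X u where "Y = add_row m X u" "X \<in> upper_sets m" "- int m \<le> u" "u \<le> threshold m X"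
      by (auto elim: add_row_cases)
    then show "\<exists>X\<in>{X \<in> upper_sets m. t \<le> threshold m X}. Y = add_row m X t"
      using Y assms threshold_add_row[of X m u] by (auto split: if_splits)
  qed
  then show ?thesis
    by (rule bij_betw_same_card[symmetric])
qed

lemma card_threshold_empty: "card {X \<in> upper_sets m. threshold m X = int m + 1} = 1"
proof -
  have "{X \<in> upper_sets m. threshold m X = int m + 1} = {{}}"
    by (auto simp: empty_upper_set threshold_eq_empty)
  then show ?thesis by simp
qed

text \<open>Raising s by one admits one more threshold, and the sets with exactly that threshold are
  counted one row lower by \<open>card_threshold_eq\<close>. This is the recursion
  \<open>row_weight_Suc\<close>.\<close>

lemma card_threshold_ge:
  "s \<le> 2 * m \<Longrightarrow> int (card {X \<in> upper_sets m. int m - int s \<le> threshold m X}) = row_weight m s"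
proof (induction m arbitrary: s)
  case 0
  have "{X \<in> upper_sets 0. int 0 - int 0 \<le> threshold 0 X} = {X \<in> upper_sets 0. threshold 0 X = int 0 + 1}"
  proof (intro Collect_cong conj_cong refl)
    fix X assume "X \<in> upper_sets 0"
    then show "int 0 - int 0 \<le> threshold 0 X \<longleftrightarrow> threshold 0 X = int 0 + 1"
      using threshold_bounds[of X 0] by auto
  qed
  then have "card {X \<in> upper_sets 0. int 0 - int 0 \<le> threshold 0 X} = 1"
    by (simp only: card_threshold_empty)
  then show ?case
    using 0 by simp
next
  case (Suc m)
  note less_IH = Suc.IH
  show ?case
    using Suc.prems
  proof (induction s)
    case 0
    have "{X \<in> upper_sets (Suc m). int (Suc m) - int 0 \<le> threshold (Suc m) X}
        = {X \<in> upper_sets (Suc m). threshold (Suc m) X = int (Suc m) + 1}"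
    proof (intro Collect_cong conj_cong refl)
      fix X assume "X \<in> upper_sets (Suc m)"
      then show "int (Suc m) - int 0 \<le> threshold (Suc m) X \<longleftrightarrow> threshold (Suc m) X = int (Suc m) + 1"
        using threshold_bounds[of X "Suc m"] by auto
    qed
    then show ?case
      by (simp only: card_threshold_empty row_weight_0 of_nat_1)
  next
    case (Suc s)
    let ?t = "int m - int s"
    have "{X \<in> upper_sets (Suc m). int (Suc m) - int (Suc s) \<le> threshold (Suc m) X}
      = {X \<in> upper_sets (Suc m). int (Suc m) - int s \<le> threshold (Suc m) X}
        \<union> {X \<in> upper_sets (Suc m). threshold (Suc m) X = ?t}"
      by auto
    then have step: "card {X \<in> upper_sets (Suc m). int (Suc m) - int (Suc s) \<le> threshold (Suc m) X}
      = card {X \<in> upper_sets (Suc m). int (Suc m) - int s \<le> threshold (Suc m) X}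
        + card {X \<in> upper_sets (Suc m). threshold (Suc m) X = ?t}"
      using finite_upper_sets[of "Suc m"] by (simp only:) (rule card_Un_disjoint, auto)
    have "int (card {X \<in> upper_sets (Suc m). threshold (Suc m) X = ?t}) = row_weight m s"
    proof (cases "s = 2 * m + 1")
      \<comment> \<open>The threshold would be -(m + 1), one column to the left of row m +
        1.\<close>
      case True
      then have "{X \<in> upper_sets (Suc m). threshold (Suc m) X = ?t} = {}"
        by (auto dest: threshold_bounds)
      then show ?thesis
        unfolding True row_weight_vanishes by (simp only: card.empty of_nat_0)
    next
      case False
      then have "s \<le> 2 * m"
        using Suc.prems by simp
      then show ?thesis
        using Suc.prems less_IH[of s] by (subst card_threshold_eq) auto
    qed
    then show ?case
      using Suc step by (simp add: row_weight_Suc)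
  qed
qed

lemma card_threshold_index:
  assumes "s \<le> 2 * m + 2"
  shows "int (card {X \<in> upper_sets (Suc m). nat (int m + 2 - threshold (Suc m) X) = s}) = padded_weight m s"
proof -
  have le: "threshold (Suc m) X \<le> int m + 2" if "X \<in> upper_sets (Suc m)" for X
    using threshold_bounds[OF that] by auto
  have eq: "{X \<in> upper_sets (Suc m). nat (int m + 2 - threshold (Suc m) X) = s}
      = {X \<in> upper_sets (Suc m). threshold (Suc m) X = int m + 2 - int s}"
    using le by auto
  consider "s = 0" | "s = 1" | "s \<ge> 2" by linarith
  then show ?thesis
  proof cases
    case 1
    then show ?thesis
      using card_threshold_empty[of "Suc m"] unfolding eq by (simp add: padded_weight_def add.commute)
  next
    case 2
    then have empty: "{X \<in> upper_sets (Suc m). threshold (Suc m) X = int m + 2 - int s} = {}"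
      by (auto dest: threshold_bounds)
    show ?thesis
      unfolding eq empty using 2 by (simp add: padded_weight_def)
  next
    case 3
    then have "card {X \<in> upper_sets (Suc m). threshold (Suc m) X = int m + 2 - int s}
        = card {X \<in> upper_sets m. int m + 2 - int s \<le> threshold m X}"
      using assms by (intro card_threshold_eq) auto
    also have "int \<dots> = row_weight m (s - 2)"
      using card_threshold_ge[of "s - 2" m] assms 3 by (simp add: of_nat_diff algebra_simps)
    finally show ?thesis
      unfolding eq using 3 by (simp add: padded_weight_def)
  qed
qed

section \<open>Counting commuting pairs\<close>

text \<open>The excluded pairs split the highest root as (\<epsilon>_(n-1) + \<epsilon>_j) +
  (\<epsilon>_n - \<epsilon>_j). Every other sum of elements of A and C that is a root can be raised
  to one of these, see \<open>positions_commute\<close>.\<close>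

definition commuting :: "nat \<Rightarrow> (int \<times> int) set \<Rightarrow> (int \<times> int) set \<Rightarrow> bool" where
  "commuting n A C \<longleftrightarrow> (\<forall>j. \<bar>j\<bar> \<le> int n - 2 \<longrightarrow>
     \<not> ((int n - 1, j) \<in> A \<and> (int n, - j) \<in> C) \<and> \<not> ((int n, - j) \<in> A \<and> (int n - 1, j) \<in> C))"

text \<open>Both rows reach their right ends, so if a common j exists at all, the threshold itself
  is one. For an empty row the default m + 2 makes the sum positive, since u is at least -(m +
  1).\<close>

lemma row_pairs_disjoint:
  assumes X: "X \<in> upper_sets (Suc m)" and u: "- int (Suc m) \<le> u" "u \<le> int m + 2"
  shows "(\<forall>j. \<bar>j\<bar> \<le> int m \<longrightarrow> \<not> (threshold (Suc m) X \<le> j \<and> j < int (Suc m) \<and> u \<le> - j \<and> - j < int m + 2))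
    \<longleftrightarrow> 0 < threshold (Suc m) X + u" (is "?l \<longleftrightarrow> ?r")
proof
  assume ?l
  show ?r
  proof (rule ccontr)
    assume *: "\<not> ?r"
    then have "threshold (Suc m) X \<noteq> int m + 2"
      using u by auto
    then have "- int (Suc m) < threshold (Suc m) X" "threshold (Suc m) X < int (Suc m)"
      using threshold_bounds[OF X] by auto
    moreover from this have "\<bar>threshold (Suc m) X\<bar> \<le> int m"
      by auto
    ultimately show False
      using \<open>?l\<close>[rule_format, of "threshold (Suc m) X"] * u by auto
  qed
qed auto

lemma commuting_add_row:
  assumes X: "X \<in> upper_sets (Suc m)" and t: "- int (Suc m) \<le> t" "t \<le> threshold (Suc m) X"
    and Y: "Y \<in> upper_sets (Suc m)" and u: "- int (Suc m) \<le> u" "u \<le> threshold (Suc m) Y"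
  shows "commuting (m + 2) (add_row (Suc m) X t) (add_row (Suc m) Y u)
    \<longleftrightarrow> 0 < threshold (Suc m) X + u \<and> 0 < threshold (Suc m) Y + t"
proof -
  have low: "(int (Suc m), j) \<in> add_row (Suc m) Z v \<longleftrightarrow> threshold (Suc m) Z \<le> j \<and> j < int (Suc m)"
    if "Z \<in> upper_sets (Suc m)" for Z v j
    using threshold_iff[OF that, of j] by (auto simp: add_row_def)
  have top: "(int m + 2, j) \<in> add_row (Suc m) Z v \<longleftrightarrow> v \<le> j \<and> j < int m + 2"
    if "Z \<in> upper_sets (Suc m)" for Z v j
    using add_row_top[OF that, of j v] by (simp add: add.commute)
  have tm: "t \<le> int m + 2" and um: "u \<le> int m + 2"
    using t u threshold_bounds[OF X] threshold_bounds[OF Y] by auto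
  then show ?thesis
    unfolding row_pairs_disjoint[OF X u(1) um, symmetric] row_pairs_disjoint[OF Y t(1) tm, symmetric]
    unfolding commuting_def using low[OF X] low[OF Y] top[OF X] top[OF Y]
    by (simp add: add.commute) blast
qed

text \<open>For lower rows with thresholds x and y, the top rows start in the intervals [1 - y, x]
  and [1 - x, y], each of size x + y. The bound -(m + 1) on the starting columns is implied, as
  thresholds are at most m + 2.\<close>

lemma card_commuting_pairs:
  "card {(A, C). A \<in> upper_sets (m + 2) \<and> C \<in> upper_sets (m + 2) \<and> commuting (m + 2) A C}
    = (\<Sum>X\<in>upper_sets (Suc m). \<Sum>Y\<in>upper_sets (Suc m). (nat (threshold (Suc m) X + threshold (Suc m) Y))\<^sup>2)"
proof -
  let ?U = "upper_sets (Suc m)"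
  let ?h = "threshold (Suc m)"
  let ?S = "SIGMA X:?U. {- int (Suc m)..?h X}"
  let ?f = "\<lambda>(X, t). add_row (Suc m) X t"
  let ?P = "SIGMA (X, Y):?U \<times> ?U. {1 - ?h Y..?h X} \<times> {1 - ?h X..?h Y}"
  let ?g = "\<lambda>((X, Y), (t, u)). (add_row (Suc m) X t, add_row (Suc m) Y u)"
  have b: "bij_betw ?f ?S (upper_sets (m + 2))"
    using bij_add_row[of "Suc m"] by simp
  have le: "?h X \<le> int m + 2" if "X \<in> ?U" for X
    using threshold_bounds[OF that] by auto
  have "bij_betw ?g ?P {(A, C). A \<in> upper_sets (m + 2) \<and> C \<in> upper_sets (m + 2) \<and> commuting (m + 2) A C}"
    unfolding bij_betw_def
  proof
    show "inj_on ?g ?P"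
    proof (rule inj_onI)
      fix p p' assume "p \<in> ?P" "p' \<in> ?P" "?g p = ?g p'"
      then obtain X Y t u X' Y' t' u'
        where *: "X \<in> ?U" "Y \<in> ?U" "t \<in> {1 - ?h Y..?h X}" "u \<in> {1 - ?h X..?h Y}"
        "X' \<in> ?U" "Y' \<in> ?U" "t' \<in> {1 - ?h Y'..?h X'}" "u' \<in> {1 - ?h X'..?h Y'}"
        and p: "p = ((X, Y), (t, u))" "p' = ((X', Y'), (t', u'))"
        and eq: "add_row (Suc m) X t = add_row (Suc m) X' t'" "add_row (Suc m) Y u = add_row (Suc m) Y' u'"
        by auto
      have "(X, t) \<in> ?S" "(X', t') \<in> ?S" "(Y, u) \<in> ?S" "(Y', u') \<in> ?S"
        using * le[of X] le[of Y] le[of X'] le[of Y'] by auto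
      then show "p = p'"
        unfolding p using inj_onD[OF bij_betw_imp_inj_on[OF b], of "(X, t)" "(X', t')"]
          inj_onD[OF bij_betw_imp_inj_on[OF b], of "(Y, u)" "(Y', u')"] eq by auto
    qed
    show "?g ` ?P = {(A, C). A \<in> upper_sets (m + 2) \<and> C \<in> upper_sets (m + 2) \<and> commuting (m + 2) A C}"
    proof (intro equalityI subsetI)
      fix p assume "p \<in> ?g ` ?P"
      then obtain X Y t u where *: "X \<in> ?U" "Y \<in> ?U" "t \<in> {1 - ?h Y..?h X}" "u \<in> {1 - ?h X..?h Y}"
        and p: "p = (add_row (Suc m) X t, add_row (Suc m) Y u)"
        by auto
      have tu: "- int (Suc m) \<le> t" "t \<le> ?h X" "- int (Suc m) \<le> u" "u \<le> ?h Y"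
        using * le[of X] le[of Y] by auto
      show "p \<in> {(A, C). A \<in> upper_sets (m + 2) \<and> C \<in> upper_sets (m + 2) \<and> commuting (m + 2) A C}"
        using commuting_add_row[OF *(1) tu(1,2) *(2) tu(3,4)] add_row_upper[OF *(1) tu(1,2)]
          add_row_upper[OF *(2) tu(3,4)] * unfolding p by auto
    next
      fix p assume "p \<in> {(A, C). A \<in> upper_sets (m + 2) \<and> C \<in> upper_sets (m + 2) \<and> commuting (m + 2) A C}"
      then obtain A C where p: "p = (A, C)" "A \<in> upper_sets (m + 2)" "C \<in> upper_sets (m + 2)" "commuting (m + 2) A C"
        by auto
      have "A \<in> upper_sets (Suc (Suc m))" "C \<in> upper_sets (Suc (Suc m))"
        using p by simp_all
      obtain X t where X: "A = add_row (Suc m) X t" "X \<in> ?U" "- int (Suc m) \<le> t" "t \<le> ?h X"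
        using \<open>A \<in> upper_sets (Suc (Suc m))\<close> by (rule add_row_cases)
      obtain Y u where Y: "C = add_row (Suc m) Y u" "Y \<in> ?U" "- int (Suc m) \<le> u" "u \<le> ?h Y"
        using \<open>C \<in> upper_sets (Suc (Suc m))\<close> by (rule add_row_cases)
      have "0 < ?h X + u \<and> 0 < ?h Y + t"
        using p(4) commuting_add_row[OF X(2-4) Y(2-4)] X(1) Y(1) by simp
      then have "((X, Y), (t, u)) \<in> ?P"
        using X Y by auto
      moreover have "p = ?g ((X, Y), (t, u))"
        using p(1) X(1) Y(1) by simp
      ultimately show "p \<in> ?g ` ?P"
        by (rule rev_image_eqI)
    qed
  qed
  then have "card {(A, C). A \<in> upper_sets (m + 2) \<and> C \<in> upper_sets (m + 2) \<and> commuting (m + 2) A C} = card ?P"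
    by (rule bij_betw_same_card[symmetric])
  also have "\<dots> = (\<Sum>(X, Y)\<in>?U \<times> ?U. card ({1 - ?h Y..?h X} \<times> {1 - ?h X..?h Y}))"
    using finite_upper_sets[of "Suc m"] by (subst card_SigmaI) (auto intro!: sum.cong)
  also have "\<dots> = (\<Sum>(X, Y)\<in>?U \<times> ?U. (nat (?h X + ?h Y))\<^sup>2)"
    by (intro sum.cong) (auto simp: power2_eq_square add.commute)
  finally show ?thesis
    by (simp add: sum.cartesian_product)
qed

lemma sum_fibres:
  fixes F :: "nat \<Rightarrow> int"
  assumes "finite U" "\<And>x. x \<in> U \<Longrightarrow> g x \<le> k"
  shows "(\<Sum>x\<in>U. F (g x)) = (\<Sum>s\<le>k. int (card {x \<in> U. g x = s}) * F s)"
proof -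
  have "(\<Sum>x\<in>U. F (g x)) = (\<Sum>s\<le>k. \<Sum>x | x \<in> U \<and> g x = s. F (g x))"
    using assms by (intro sum.group[symmetric]) auto
  also have "\<dots> = (\<Sum>s\<le>k. int (card {x \<in> U. g x = s}) * F s)"
    by (intro sum.cong) auto
  finally show ?thesis .
qed

lemma threshold_sum:
  "(\<Sum>X\<in>upper_sets (Suc m). F (nat (int m + 2 - threshold (Suc m) X)))
    = (\<Sum>s\<le>2 * m + 2. padded_weight m s * F s)"
proof -
  have "(\<Sum>X\<in>upper_sets (Suc m). F (nat (int m + 2 - threshold (Suc m) X)))
    = (\<Sum>s\<le>2 * m + 2. int (card {X \<in> upper_sets (Suc m). nat (int m + 2 - threshold (Suc m) X) = s}) * F s)"
  proof (rule sum_fibres[OF finite_upper_sets])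
    fix X assume "X \<in> upper_sets (Suc m)"
    then show "nat (int m + 2 - threshold (Suc m) X) \<le> 2 * m + 2"
      using threshold_bounds[of X "Suc m"] by auto
  qed
  also have "\<dots> = (\<Sum>s\<le>2 * m + 2. padded_weight m s * F s)"
    by (intro sum.cong refl) (simp add: card_threshold_index)
  finally show ?thesis .
qed

lemma padded_weight_vanishes: "padded_weight m (2 * m + 3) = 0"
  using row_weight_vanishes[of m] by (simp add: padded_weight_def eval_nat_numeral)

lemma card_commuting:
  "int (card {(A, C). A \<in> upper_sets (m + 2) \<and> C \<in> upper_sets (m + 2) \<and> commuting (m + 2) A C})
    = (3 * int m + 11) * 2 ^ (2 * m + 2) - 2 * (3 * int m + 5) * int ((2 * m + 2) choose (m + 1))"
proof -
  let ?U = "upper_sets (Suc m)"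
  let ?i = "\<lambda>X. nat (int m + 2 - threshold (Suc m) X)"
  let ?N = "2 * m + 4"
  let ?V = "padded_weight m"
  \<comment> \<open>In terms of the distances s and s', the sum of the thresholds is 2 m + 4 - s -
    s'; subtraction on natural numbers cuts off negative sums.\<close>
  let ?K = "\<lambda>s s'. int ((?N - s - s')\<^sup>2)"
  have split: "(\<Sum>s\<le>?N. f s) = (\<Sum>s\<le>2 * m + 2. f s) + f (2 * m + 3) + f ?N" for f :: "nat \<Rightarrow> int"
  proof -
    have "?N = Suc (Suc (2 * m + 2))" "2 * m + 3 = Suc (2 * m + 2)" by simp_all
    then show ?thesis by (simp only: sum.atMost_Suc)
  qed
  have "nat (threshold (Suc m) X + threshold (Suc m) Y) = ?N - ?i X - ?i Y" if "X \<in> ?U" "Y \<in> ?U" for X Y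
    using threshold_bounds[OF that(1)] threshold_bounds[OF that(2)] by auto
  then have "int (card {(A, C). A \<in> upper_sets (m + 2) \<and> C \<in> upper_sets (m + 2) \<and> commuting (m + 2) A C})
      = (\<Sum>X\<in>?U. \<Sum>Y\<in>?U. ?K (?i X) (?i Y))"
    unfolding card_commuting_pairs by (simp only: of_nat_sum cong: sum.cong)
  also have "\<dots> = (\<Sum>X\<in>?U. \<Sum>s'\<le>2 * m + 2. ?V s' * ?K (?i X) s')"
    by (intro sum.cong refl threshold_sum)
  also have "\<dots> = (\<Sum>s\<le>2 * m + 2. ?V s * (\<Sum>s'\<le>2 * m + 2. ?V s' * ?K s s'))"
    by (rule threshold_sum)
  \<comment> \<open>Two vanishing terms are added: at 2 m + 3 the weight is 0, and at 2 m + 4 the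
    truncated difference is 0.\<close>
  also have "\<dots> = (\<Sum>s\<le>2 * m + 2. ?V s * (\<Sum>s'\<le>?N. ?V s' * ?K s s'))"
    unfolding split padded_weight_vanishes by simp
  also have "\<dots> = (\<Sum>s\<le>?N. ?V s * (\<Sum>s'\<le>?N. ?V s' * ?K s s'))"
    unfolding split[of "\<lambda>s. ?V s * (\<Sum>s'\<le>?N. ?V s' * ?K s s')"] padded_weight_vanishes by simp
  \<comment> \<open>Beyond \<open>?N - s\<close> the square is 0, so the double sum becomes a Cauchy
    product.\<close>
  also have "\<dots> = (\<Sum>s\<le>?N. ?V s * (\<Sum>s'\<le>?N - s. ?V s' * ?K s s'))"
    by (intro sum.cong refl arg_cong2[of _ _ _ _ "(*)"] sum.mono_neutral_right) auto
  also have "\<dots> = (Abs_fps ?V * (Abs_fps ?V * squares)) $ ?N"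
    unfolding fps_mult_nth squares_def by (simp add: atMost_atLeast0)
  also have "\<dots> = (squares * Abs_fps ?V * Abs_fps ?V) $ ?N"
    by (simp only: mult_ac)
  finally show ?thesis
    unfolding weighted_sum_closed .
qed

section \<open>Cells and weights of the affine algebra\<close>

lemma so_zero: "0 \<in> so n"
  by (simp add: so_def)

lemma so_add: "A \<in> so n \<Longrightarrow> B \<in> so n \<Longrightarrow> A + B \<in> so n"
  unfolding so_def by (auto simp: plus_fun_def) (metis add.right_neutral)+

lemma so_scale: "A \<in> so n \<Longrightarrow> mat_scale r A \<in> so n"
  by (auto simp: so_def mat_scale_def)

lemma so_sum: "(\<And>k. k \<in> K \<Longrightarrow> A k \<in> so n) \<Longrightarrow> (\<Sum>k\<in>K. A k) \<in> so n"
  by (induction K rule: infinite_finite_induct) (auto simp: so_zero so_add)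

lemma so_mirror: "A \<in> so n \<Longrightarrow> A (- j) (- i) = - A i j"
  by (simp add: so_def)

lemma so_nonzero:
  assumes "A \<in> so n" "A i j \<noteq> 0"
  shows "\<bar>i\<bar> \<le> int n" "\<bar>j\<bar> \<le> int n" "i \<noteq> - j" "A (- j) (- i) \<noteq> 0"
proof -
  show "\<bar>i\<bar> \<le> int n" "\<bar>j\<bar> \<le> int n"
    using assms unfolding so_def by blast+
  show "A (- j) (- i) \<noteq> 0"
    using assms by (simp add: so_mirror)
  show "i \<noteq> - j"
    using assms so_mirror[OF assms(1), of j i] by auto
qed

lemma mat_bracket_entry_nonzero:
  assumes "mat_bracket n A B i j \<noteq> 0"
  obtains p where "A i p \<noteq> 0" "B p j \<noteq> 0" | p where "B i p \<noteq> 0" "A p j \<noteq> 0"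
proof -
  obtain p where "A i p * B p j - B i p * A p j \<noteq> 0"
    using assms unfolding mat_bracket_def by (meson sum.not_neutral_contains_not_neutral)
  then show ?thesis
    using that by (cases "A i p \<noteq> 0 \<and> B p j \<noteq> 0") auto
qed

lemma so_bracket:
  assumes A: "A \<in> so n" and B: "B \<in> so n"
  shows "mat_bracket n A B \<in> so n"
proof -
  have "mat_bracket n A B (- j) (- i) = - mat_bracket n A B i j" for i j
  proof -
    have "mat_bracket n A B (- j) (- i)
        = (\<Sum>k = - int n..int n. A (- j) (- k) * B (- k) (- i) - B (- j) (- k) * A (- k) (- i))"
      unfolding mat_bracket_def
      by (rule sum.reindex_bij_witness[of _ uminus uminus]) auto
    also have "\<dots> = - mat_bracket n A B i j"
      unfolding mat_bracket_def so_mirror[OF A] so_mirror[OF B] sum_negf[symmetric]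
      by (intro sum.cong refl) (simp add: algebra_simps)
    finally show ?thesis .
  qed
  moreover have "\<bar>i\<bar> \<le> int n \<and> \<bar>j\<bar> \<le> int n" if "mat_bracket n A B i j \<noteq> 0" for i j
    using that by (rule mat_bracket_entry_nonzero) (use so_nonzero[OF A] so_nonzero[OF B] in blast)+
  ultimately show ?thesis
    unfolding so_def by blast
qed

lemma mat_bracket_zero [simp]: "mat_bracket n A 0 = 0" "mat_bracket n 0 A = 0"
  by (simp_all add: mat_bracket_def fun_eq_iff)

lemma mat_bracket_flip: "mat_bracket n B A = - mat_bracket n A B"
  unfolding mat_bracket_def fun_eq_iff uminus_apply sum_negf[symmetric] by simp

lemma killing_zero [simp]: "killing n A 0 = 0"
  by (simp add: killing_def trace_on_def Let_def matv.representation_zero)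

text \<open>Root vectors of \<open>so n\<close> for p different from q and -q, and Cartan elements
  for p = q. The matrix is zero for q = -p, and the mirror position (-q, -p) gives its
  negative.\<close>

definition unit_mat :: "int \<Rightarrow> int \<Rightarrow> matrix" where
  "unit_mat p q = (\<lambda>i j. (if i = p \<and> j = q then 1 else 0) - (if i = - q \<and> j = - p then 1 else 0))"

lemma unit_mat_nonzero: "unit_mat p q i j \<noteq> 0 \<Longrightarrow> (i = p \<and> j = q) \<or> (i = - q \<and> j = - p)"
  by (auto simp: unit_mat_def split: if_splits)

lemma unit_mat_so:
  assumes "\<bar>p\<bar> \<le> int n" "\<bar>q\<bar> \<le> int n"
  shows "unit_mat p q \<in> so n"
proof -
  have "\<bar>i\<bar> \<le> int n \<and> \<bar>j\<bar> \<le> int n" if "unit_mat p q i j \<noteq> 0" for i j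
    using unit_mat_nonzero[OF that] assms by auto
  moreover have "unit_mat p q (- j) (- i) = - unit_mat p q i j" for i j
  proof -
    have "- j = p \<and> - i = q \<longleftrightarrow> i = - q \<and> j = - p" "- j = - q \<and> - i = - p \<longleftrightarrow> i = p \<and> j = q"
      by linarith+
    then show ?thesis
      unfolding unit_mat_def by simp
  qed
  ultimately show ?thesis
    unfolding so_def by blast
qed

lemma unit_mat_cartan: "\<bar>p\<bar> \<le> int n \<Longrightarrow> unit_mat p p \<in> cartan n"
  unfolding cartan_def using unit_mat_so[of p n p] unit_mat_nonzero[of p p] by auto

text \<open>The inequalities keep the mirrored entries from contributing, so only the term k = p of
  the product survives.\<close>

lemma unit_mat_bracket:
  assumes "\<bar>p\<bar> \<le> int n" "\<bar>q\<bar> \<le> int n" "p \<noteq> q" "p \<noteq> - q" "r \<noteq> - p" "r \<noteq> - q"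
  shows "mat_bracket n (unit_mat r p) (unit_mat p q) r q = 1"
proof -
  have "unit_mat r p r k * unit_mat p q k q - unit_mat p q r k * unit_mat r p k q = (if k = p then 1 else 0)" for k
    using assms by (auto simp: unit_mat_def)
  moreover have "p \<in> {- int n..int n}"
    using assms(1) by auto
  ultimately show ?thesis
    unfolding mat_bracket_def by simp
qed

lemma aff_scale_simp: "aff_scale r (f, a, b) = ((\<lambda>k. mat_scale r (f k)), r * a, r * b)"
  by (simp add: aff_scale_def)

section \<open>Tensors and coordinate subspaces\<close>

lemma sum_tensor:
  "finite K \<Longrightarrow> (\<Sum>k\<in>K. tensor_t (f k) k) = ((\<lambda>m. if m \<in> K then f m else 0), 0, 0)"
  by (induction K rule: finite_induct) (auto simp: tensor_t_def zero_prod_def fun_eq_iff)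

lemma tensor_scale: "tensor_t (mat_scale r A) k = aff_scale r (tensor_t A k)"
  by (auto simp: tensor_t_def aff_scale_simp mat_scale_def fun_eq_iff)

lemma tensor_zero: "tensor_t 0 k = 0"
  by (simp add: tensor_t_def zero_prod_def fun_eq_iff)

lemma tensor_add: "tensor_t (A + B) k = tensor_t A k + tensor_t B k"
  by (simp add: tensor_t_def fun_eq_iff)

lemma tensor_sum: "tensor_t (\<Sum>x\<in>X. A x) k = (\<Sum>x\<in>X. tensor_t (A x) k)"
proof (induction X rule: infinite_finite_induct)
  case (insert x F)
  show ?case
    unfolding sum.insert[OF insert.hyps] tensor_add insert.IH ..
next
  case (infinite X)
  show ?case
    unfolding sum.infinite[OF infinite] by (rule tensor_zero)
qed (simp only: sum.empty tensor_zero)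

text \<open>A cell \<open>(k, i, j)\<close> addresses the coefficient of \<open>t\<^sup>k\<close> at the matrix position \<open>(i, j)\<close>.\<close>

definition coord_space :: "nat \<Rightarrow> (int \<times> int \<times> int) set \<Rightarrow> aff set" where
  "coord_space n S = {(f, a, b). a = 0 \<and> b = 0 \<and> finite {k. f k \<noteq> 0} \<and> (\<forall>k. f k \<in> so n)
     \<and> (\<forall>k i j. f k i j \<noteq> 0 \<longrightarrow> (k, i, j) \<in> S)}"

definition pos_cells :: "(int \<times> int \<times> int) set" where
  "pos_cells = {(k, i, j). k > 0 \<or> k = 0 \<and> i < j}"

lemma coord_space_subspace: "aff.subspace (coord_space n S)"
proof (unfold aff.subspace_def, intro conjI ballI allI)
  show "0 \<in> coord_space n S"
    by (simp add: coord_space_def zero_prod_def so_zero)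
next
  fix x y assume "x \<in> coord_space n S" "y \<in> coord_space n S"
  then obtain f g where fg: "x = (f, 0, 0)" "finite {k. f k \<noteq> 0}" "\<And>k. f k \<in> so n" "\<And>k i j. f k i j \<noteq> 0 \<Longrightarrow> (k, i, j) \<in> S"
    "y = (g, 0, 0)" "finite {k. g k \<noteq> 0}" "\<And>k. g k \<in> so n" "\<And>k i j. g k i j \<noteq> 0 \<Longrightarrow> (k, i, j) \<in> S"
    unfolding coord_space_def by auto
  have "finite {k. (f + g) k \<noteq> 0}"
    by (rule finite_subset[of _ "{k. f k \<noteq> 0} \<union> {k. g k \<noteq> 0}"]) (use fg in \<open>auto simp del: zero_fun_apply\<close>)
  moreover have "(k, i, j) \<in> S" if "(f + g) k i j \<noteq> 0" for k i j
    using that fg(4)[of k i j] fg(8)[of k i j] by (cases "f k i j = 0") auto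
  ultimately show "x + y \<in> coord_space n S"
    using fg by (simp add: coord_space_def so_add)
next
  fix r x assume "x \<in> coord_space n S"
  then obtain f where f: "x = (f, 0, 0)" "finite {k. f k \<noteq> 0}" "\<And>k. f k \<in> so n" "\<And>k i j. f k i j \<noteq> 0 \<Longrightarrow> (k, i, j) \<in> S"
    unfolding coord_space_def by auto
  have "finite {k. mat_scale r (f k) \<noteq> 0}"
    by (rule finite_subset[OF _ f(2)]) auto
  moreover have "(k, i, j) \<in> S" if "mat_scale r (f k) i j \<noteq> 0" for k i j
    using that f(4)[of k i j] by (simp add: mat_scale_def)
  ultimately show "aff_scale r x \<in> coord_space n S"
    using f by (simp add: coord_space_def so_scale aff_scale_simp)
qed

lemma finite_tensor_support: "finite {m. (if m = k then A else 0) \<noteq> (0 :: matrix)}"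
  by (rule finite_subset[of _ "{k}"]) (auto split: if_splits)

lemma tensor_coord_space:
  assumes "A \<in> so n" "\<And>i j. A i j \<noteq> 0 \<Longrightarrow> (k, i, j) \<in> S"
  shows "tensor_t A k \<in> coord_space n S"
  using assms finite_tensor_support[of k A]
  by (auto simp: coord_space_def tensor_t_def so_zero split: if_splits)

lemma tensor_unit_coord_space:
  assumes "\<bar>p\<bar> \<le> int n" "\<bar>q\<bar> \<le> int n" "(k, p, q) \<in> S" "(k, - q, - p) \<in> S"
  shows "tensor_t (unit_mat p q) k \<in> coord_space n S"
  using assms unit_mat_nonzero by (intro tensor_coord_space unit_mat_so) blast+

lemma aff_nilp_coord: "aff_nilp n = coord_space n pos_cells"
proof
  show "aff_nilp n \<subseteq> coord_space n pos_cells"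
    unfolding aff_nilp_def
    by (rule aff.span_minimal[OF _ coord_space_subspace])
      (auto simp: nilp_def pos_cells_def intro!: tensor_coord_space)
  show "coord_space n pos_cells \<subseteq> aff_nilp n"
  proof
    fix x assume "x \<in> coord_space n pos_cells"
    then obtain f where f: "x = (f, 0, 0)" "finite {k. f k \<noteq> 0}" "\<And>k. f k \<in> so n"
      "\<And>k i j. f k i j \<noteq> 0 \<Longrightarrow> k > 0 \<or> k = 0 \<and> i < j"
      unfolding coord_space_def pos_cells_def by auto
    have "x = (\<Sum>k | f k \<noteq> 0. tensor_t (f k) k)"
      unfolding sum_tensor[OF f(2)] f(1) by (auto simp: fun_eq_iff)
    also have "\<dots> \<in> aff_nilp n"
      unfolding aff_nilp_def
    proof (intro aff.span_sum aff.span_base)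
      fix k assume "k \<in> {k. f k \<noteq> 0}"
      then obtain i j where "f k i j \<noteq> 0"
        by (auto simp: fun_eq_iff)
      then have "k > 0 \<or> k = 0 \<and> f k \<in> nilp n"
        using f(3,4) by (auto simp: nilp_def)
      then show "tensor_t (f k) k \<in> {tensor_t x 0 |x. x \<in> nilp n} \<union> {tensor_t x k |x k. x \<in> so n \<and> k > 0}"
        using f(3) by blast
    qed
    finally show "x \<in> aff_nilp n" .
  qed
qed

lemma aff_cartan_zero: "0 \<in> aff_cartan n"
  by (simp add: aff_cartan_def aff.span_zero)

lemma aff_nilp_zero: "0 \<in> aff_nilp n"
  by (simp add: aff_nilp_def aff.span_zero)

lemma aff_cartan_borel: "aff_cartan n \<subseteq> aff_borel n"
proof
  fix x assume "x \<in> aff_cartan n"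
  moreover have "x = x + 0" by simp
  ultimately show "x \<in> aff_borel n"
    unfolding aff_borel_def using aff_nilp_zero by blast
qed

lemma aff_nilp_borel: "aff_nilp n \<subseteq> aff_borel n"
proof
  fix x assume "x \<in> aff_nilp n"
  moreover have "x = 0 + x" by simp
  ultimately show "x \<in> aff_borel n"
    unfolding aff_borel_def using aff_cartan_zero by blast
qed

lemma cartan_so: "A \<in> cartan n \<Longrightarrow> A \<in> so n"
  by (simp add: cartan_def)

lemma aff_borel_cases:
  assumes "x \<in> aff_borel n"
  obtains f a b where "x = (f, a, b)" "finite {k. f k \<noteq> 0}" "\<And>k. f k \<in> so n"
    "\<And>k i j. f k i j \<noteq> 0 \<Longrightarrow> k > 0 \<or> k = 0 \<and> i \<le> j"
proof -
  obtain y z where x: "x = y + z" "y \<in> aff_cartan n" "z \<in> aff_nilp n"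
    using assms by (auto simp: aff_borel_def)
  obtain h a b where y: "y = (h, a, b)" "h 0 \<in> cartan n" "\<And>k. k \<noteq> 0 \<Longrightarrow> h k = 0"
    using x(2) by (auto simp: aff_cartan_explicit)
  obtain f where z: "z = (f, 0, 0)" "finite {k. f k \<noteq> 0}" "\<And>k. f k \<in> so n"
    "\<And>k i j. f k i j \<noteq> 0 \<Longrightarrow> k > 0 \<or> k = 0 \<and> i < j"
    using x(3) unfolding aff_nilp_coord coord_space_def pos_cells_def by auto
  have hso: "h k \<in> so n" for k
    using y(2,3) by (cases "k = 0") (auto simp: cartan_so so_zero)
  show ?thesis
  proof
    show "x = (h + f, a, b)"
      by (simp add: x y z)
    show "finite {k. (h + f) k \<noteq> 0}"
      by (rule finite_subset[of _ "insert 0 {k. f k \<noteq> 0}"]) (use y(3) z(2) in \<open>auto simp del: zero_fun_apply\<close>)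
    show "(h + f) k \<in> so n" for k
      using hso z(3) by (simp add: so_add)
    show "k > 0 \<or> k = 0 \<and> i \<le> j" if "(h + f) k i j \<noteq> 0" for k i j
    proof (cases "f k i j = 0")
      case True
      then have "h k i j \<noteq> 0" using that by simp
      then have "k = 0" using y(3)[of k] by (metis zero_fun_apply)
      then show ?thesis
        using \<open>h k i j \<noteq> 0\<close> y(2) by (auto simp: cartan_def)
    next
      case False
      then show ?thesis using z(4) by fastforce
    qed
  qed
qed

section \<open>Weights of cells and root spaces\<close>

text \<open>The eigenvalue of the Cartan subalgebra on an entry, set to 0 elsewhere to match the
  normalisation in \<open>dual_space\<close>.\<close>

definition cell_weight :: "nat \<Rightarrow> int \<times> int \<times> int \<Rightarrow> aff \<Rightarrow> complex" where
  "cell_weight n = (\<lambda>(k, i, j) x. if x \<in> aff_cartan n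
     then fst x 0 i i - fst x 0 j j + of_int k * snd (snd x) else 0)"

lemma cell_weight_mirror: "cell_weight n (k, - j, - i) = cell_weight n (k, i, j)"
proof
  fix x show "cell_weight n (k, - j, - i) x = cell_weight n (k, i, j) x"
  proof (cases "x \<in> aff_cartan n")
    case True
    then have "fst x 0 \<in> so n"
      by (auto simp: aff_cartan_explicit cartan_so)
    then show ?thesis
      by (simp add: cell_weight_def so_mirror)
  qed (simp add: cell_weight_def)
qed

lemma cell_weight_diag: "cell_weight n (k, i, i) = cell_weight n (k, j, j)"
  by (simp add: cell_weight_def fun_eq_iff)

lemma delta_cell_weight: "delta n = cell_weight n (1, i, i)"
  by (simp add: cell_weight_def delta_def fun_eq_iff)

lemma cell_weight_zero: "cell_weight n (0, 0, 0) = 0"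
  by (simp add: cell_weight_def fun_eq_iff)

lemma cell_weight_dual: "cell_weight n c \<in> dual_space aff_scale (aff_cartan n)"
proof -
  have "x + y \<in> aff_cartan n" "aff_scale r x \<in> aff_cartan n" if "x \<in> aff_cartan n" "y \<in> aff_cartan n" for x y r
    using that by (auto simp: aff_cartan_def intro: aff.span_add aff.span_scale)
  then show ?thesis
    by (cases c) (auto simp: dual_space_def cell_weight_def aff_scale_def mat_scale_def algebra_simps split: prod.splits)
qed

lemma tensor_unit_cartan: "\<bar>p\<bar> \<le> int n \<Longrightarrow> tensor_t (unit_mat p p) 0 \<in> aff_cartan n"
  unfolding aff_cartan_def by (intro aff.span_base) (auto intro: unit_mat_cartan)

text \<open>\<open>c p i\<close> is the i-th diagonal entry of \<open>unit_mat p p\<close>. Over the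
  integers, and with the four indices as the only tests, this is a finite case distinction.\<close>

lemma signed_indicators:
  fixes i j i' j' :: int
  defines "c \<equiv> \<lambda>p i. (if i = p then 1 else 0) - (if i = - p then 1 else (0 :: int))"
  assumes "\<And>p. p \<in> {i, j, i', j'} \<Longrightarrow> c p i - c p j = c p i' - c p j'"
  shows "i = i' \<and> j = j' \<or> i = - j' \<and> j = - i' \<or> i = j \<and> i' = j'"
  using assms(2)[of i] assms(2)[of j] assms(2)[of i'] assms(2)[of j'] unfolding c_def
  by (smt (verit) insertCI)

text \<open>Evaluation at \<open>d_elem\<close> gives the degree, and evaluation at diagonal unit
  matrices gives the position up to the mirror symmetry, except that all diagonal cells of one
  degree share a weight.\<close>

lemma cell_weight_eq:
  assumes "cell_weight n (k, i, j) = cell_weight n (k', i', j')"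
    and "\<bar>i\<bar> \<le> int n" "\<bar>j\<bar> \<le> int n" "\<bar>i'\<bar> \<le> int n" "\<bar>j'\<bar> \<le> int n"
  shows "k = k'" "i = i' \<and> j = j' \<or> i = - j' \<and> j = - i' \<or> i = j \<and> i' = j'"
proof -
  have "d_elem \<in> aff_cartan n"
    by (simp add: aff_cartan_def aff.span_base)
  then show "k = k'"
    using fun_cong[OF assms(1), of d_elem] by (simp add: cell_weight_def d_elem_def)
  show "i = i' \<and> j = j' \<or> i = - j' \<and> j = - i' \<or> i = j \<and> i' = j'"
  proof (rule signed_indicators)
    let ?c = "\<lambda>p i. (if i = p then 1 else 0) - (if i = - p then 1 else (0 :: int))"
    fix p assume "p \<in> {i, j, i', j'}"
    then have "\<bar>p\<bar> \<le> int n"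
      using assms by auto
    then have "unit_mat p p i i - unit_mat p p j j = unit_mat p p i' i' - unit_mat p p j' j'"
      using fun_cong[OF assms(1), of "tensor_t (unit_mat p p) 0"] tensor_unit_cartan[of p n]
      by (simp add: cell_weight_def tensor_t_def)
    moreover have "unit_mat p p l l = of_int (?c p l)" for l
      by (simp add: unit_mat_def)
    ultimately have "(of_int (?c p i - ?c p j) :: complex) = of_int (?c p i' - ?c p j')"
      by (simp only: of_int_diff)
    then show "?c p i - ?c p j = ?c p i' - ?c p j'"
      by (simp only: of_int_eq_iff)
  qed
qed

lemma aff_bracket_cell:
  assumes "h \<in> aff_cartan n" "\<And>k. f k \<in> so n"
  shows "aff_bracket n h (f, a, b) = ((\<lambda>k i j. cell_weight n (k, i, j) h * f k i j), 0, 0)"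
proof -
  obtain g p q where h: "h = (g, p, q)" "g 0 \<in> cartan n" "\<forall>k. k \<noteq> 0 \<longrightarrow> g k = 0"
    using assms(1) by (auto simp: aff_cartan_explicit)
  have "\<forall>k. f k \<in> so n"
    using assms(2) by simp
  note br = aff_bracket_cartan[OF h(2,3) this, of p q a b]
  have "mat_bracket n (g 0) (f m) + mat_scale (q * of_int m) (f m)
      = (\<lambda>i j. cell_weight n (m, i, j) h * f m i j)" for m
    using assms(1) mat_bracket_cartan[OF h(2) assms(2)[of m]]
    by (simp add: h(1) cell_weight_def mat_scale_def fun_eq_iff algebra_simps)
  then show ?thesis
    using br unfolding h(1) by (auto simp: prod_eq_iff)
qed

lemma root_spaceD:
  assumes "(f, a, b) \<in> aff_root_space n \<alpha>" "\<alpha> \<in> dual_space aff_scale (aff_cartan n)"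
  shows "finite {k. f k \<noteq> 0}" "\<And>k. f k \<in> so n"
    "\<And>k i j. f k i j \<noteq> 0 \<Longrightarrow> \<alpha> = cell_weight n (k, i, j)" "\<alpha> \<noteq> 0 \<Longrightarrow> a = 0 \<and> b = 0"
proof -
  show "finite {k. f k \<noteq> 0}" and f: "\<And>k. f k \<in> so n"
    using assms(1) by (auto simp: aff_root_space_def weight_space_def affine_alg_def)
  have br: "((\<lambda>k i j. cell_weight n (k, i, j) h * f k i j), 0, 0) = aff_scale (\<alpha> h) (f, a, b)"
    if "h \<in> aff_cartan n" for h
    using assms(1) that aff_bracket_cell[OF that f, where a = a and b = b]
    by (auto simp: aff_root_space_def weight_space_def)
  have out: "\<alpha> h = 0" if "h \<notin> aff_cartan n" for h
    using assms(2) that unfolding dual_space_def by blast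
  show "\<alpha> = cell_weight n (k, i, j)" if "f k i j \<noteq> 0" for k i j
  proof
    fix h show "\<alpha> h = cell_weight n (k, i, j) h"
    proof (cases "h \<in> aff_cartan n")
      case True
      then have "cell_weight n (k, i, j) h * f k i j = \<alpha> h * f k i j"
        using br[OF True] by (simp add: aff_scale_simp mat_scale_def fun_eq_iff)
      then show ?thesis using that by simp
    next
      case False
      then show ?thesis by (simp add: out cell_weight_def)
    qed
  qed
  \<comment> \<open>A bracket with a Cartan element has no component along c or d, so a nonzero
    eigenvalue forces these coordinates to vanish.\<close>
  show "a = 0 \<and> b = 0" if "\<alpha> \<noteq> 0"
  proof -
    have "\<exists>h. \<alpha> h \<noteq> 0"
      using that by (metis ext zero_fun_apply)
    then obtain h where h: "\<alpha> h \<noteq> 0" ..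
    then have "h \<in> aff_cartan n"
      using out by blast
    from br[OF this] show ?thesis
      using h by (simp add: aff_scale_simp)
  qed
qed

lemma root_spaceI:
  assumes "finite {k. f k \<noteq> 0}" "\<And>k. f k \<in> so n" "\<And>k i j. f k i j \<noteq> 0 \<Longrightarrow> cell_weight n (k, i, j) = \<alpha>"
  shows "(f, 0, 0) \<in> aff_root_space n \<alpha>"
proof -
  have "(\<lambda>k i j. cell_weight n (k, i, j) h * f k i j) = (\<lambda>k. mat_scale (\<alpha> h) (f k))" for h
    using assms(3) by (fastforce simp: fun_eq_iff mat_scale_def)
  then show ?thesis
    using assms(1,2) unfolding aff_root_space_def weight_space_def affine_alg_def
    by (auto simp: aff_bracket_cell aff_scale_simp)
qed

lemma tensor_unit_root_space:
  assumes "\<bar>p\<bar> \<le> int n" "\<bar>q\<bar> \<le> int n"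
  shows "tensor_t (unit_mat p q) k \<in> aff_root_space n (cell_weight n (k, p, q))"
  unfolding tensor_t_def
proof (rule root_spaceI)
  show "finite {m. (if m = k then unit_mat p q else 0) \<noteq> 0}"
    by (rule finite_tensor_support)
  show "(if m = k then unit_mat p q else 0) \<in> so n" for m
    using assms by (simp add: unit_mat_so so_zero)
  show "cell_weight n (m, i, j) = cell_weight n (k, p, q)"
    if "(if m = k then unit_mat p q else 0) i j \<noteq> 0" for m i j
    using that unit_mat_nonzero[of p q i j] cell_weight_mirror[of n k q p] by (auto split: if_splits)
qed

lemma pos_cell_weight_nonzero:
  assumes "(k, i, j) \<in> pos_cells" "\<bar>i\<bar> \<le> int n" "\<bar>j\<bar> \<le> int n"
  shows "cell_weight n (k, i, j) \<noteq> 0"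
  using cell_weight_eq[of n k i j 0 0 0] assms unfolding cell_weight_zero
  by (auto simp: pos_cells_def)

text \<open>Cells of equal weight are all positive or all not, so the whole root space lies in the
  nilpotent part.\<close>

lemma pos_cell_weight:
  assumes "(k, i, j) \<in> pos_cells" "\<bar>i\<bar> \<le> int n" "\<bar>j\<bar> \<le> int n"
    and "x \<in> aff_root_space n (cell_weight n (k, i, j))" "x \<noteq> 0"
  shows "cell_weight n (k, i, j) \<in> aff_pos_roots n"
proof -
  let ?\<alpha> = "cell_weight n (k, i, j)"
  have "?\<alpha> \<noteq> 0"
    using assms(1-3) by (rule pos_cell_weight_nonzero)
  moreover have "aff_root_space n ?\<alpha> \<subseteq> aff_nilp n"
  proof
    fix y assume y: "y \<in> aff_root_space n ?\<alpha>"
    obtain f a b where f: "y = (f, a, b)" by (cases y)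
    note D = root_spaceD[OF y[unfolded f] cell_weight_dual]
    have "(k', i', j') \<in> pos_cells" if "f k' i' j' \<noteq> 0" for k' i' j'
      using cell_weight_eq[OF D(3)[OF that] assms(2,3) so_nonzero(1,2)[OF D(2) that]] assms(1)
      by (auto simp: pos_cells_def)
    then show "y \<in> aff_nilp n"
      using D \<open>?\<alpha> \<noteq> 0\<close> unfolding f aff_nilp_coord coord_space_def by auto
  qed
  moreover have "aff_root_space n ?\<alpha> \<noteq> {0}"
    using assms(4,5) by blast
  ultimately show ?thesis
    using cell_weight_dual unfolding aff_pos_roots_def roots_def aff_root_space_def by blast
qed

section \<open>Weight components of ideal elements\<close>

definition weight_part :: "nat \<Rightarrow> (aff \<Rightarrow> complex) \<Rightarrow> aff \<Rightarrow> aff" where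
  "weight_part n \<alpha> x = ((\<lambda>k i j. if cell_weight n (k, i, j) = \<alpha> then fst x k i j else 0), 0, 0)"

lemma sum_weight_part:
  "finite \<Lambda> \<Longrightarrow> (\<Sum>\<alpha>\<in>\<Lambda>. weight_part n \<alpha> x)
    = ((\<lambda>k i j. if cell_weight n (k, i, j) \<in> \<Lambda> then fst x k i j else 0), 0, 0)"
  by (induction \<Lambda> rule: finite_induct) (auto simp: weight_part_def zero_prod_def intro!: ext)

lemma weight_part_root_space:
  assumes "x \<in> aff_nilp n"
  shows "weight_part n \<alpha> x \<in> aff_root_space n \<alpha>"
proof -
  obtain f where f: "x = (f, 0, 0)" "finite {k. f k \<noteq> 0}" "\<And>k. f k \<in> so n"
    using assms unfolding aff_nilp_coord coord_space_def by auto
  let ?g = "\<lambda>k i j. if cell_weight n (k, i, j) = \<alpha> then f k i j else 0"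
  have "finite {k. ?g k \<noteq> 0}"
    by (rule finite_subset[OF _ f(2)]) (auto simp: fun_eq_iff split: if_splits)
  moreover have "?g k \<in> so n" for k
    unfolding so_def using so_nonzero(1,2)[OF f(3)] so_mirror[OF f(3)] by (auto simp: cell_weight_mirror)
  ultimately show ?thesis
    unfolding weight_part_def f(1) fst_conv by (intro root_spaceI) (auto split: if_splits)
qed

text \<open>These assumptions already force I to contain the weight components of its elements,
  since Cartan elements act diagonally on the cells.\<close>

locale graded_ideal =
  fixes n :: nat and I :: "aff set"
  assumes subspace: "aff.subspace I" and nilp: "I \<subseteq> aff_nilp n"
    and ideal: "\<And>x y. x \<in> aff_borel n \<Longrightarrow> y \<in> I \<Longrightarrow> aff_bracket n x y \<in> I"
begin

lemma element_cases:
  assumes "x \<in> I"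
  obtains f where "x = (f, 0, 0)" "finite {k. f k \<noteq> 0}" "\<And>k. f k \<in> so n"
    "\<And>k i j. f k i j \<noteq> 0 \<Longrightarrow> (k, i, j) \<in> pos_cells"
  using assms nilp unfolding aff_nilp_coord coord_space_def by auto

text \<open>To isolate the part of weight \<open>\<alpha>\<close>, each other weight \<open>\<beta>\<close> is removed by \<open>ad h - \<beta> h\<close> for some
  \<open>h\<close> with \<open>\<alpha> h \<noteq> \<beta> h\<close>.\<close>

lemma weight_part_finite:
  assumes "finite \<Lambda>"
  shows "\<Lambda> \<subseteq> range (cell_weight n) \<Longrightarrow> x \<in> I
    \<Longrightarrow> (\<And>k i j. fst x k i j \<noteq> 0 \<Longrightarrow> cell_weight n (k, i, j) \<in> \<Lambda>) \<Longrightarrow> \<alpha> \<in> \<Lambda> \<Longrightarrow> weight_part n \<alpha> x \<in> I"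
  using assms
proof (induction \<Lambda> arbitrary: x \<alpha> rule: finite_induct)
  case (insert \<beta> \<Lambda>)
  obtain f where f: "x = (f, 0, 0)" "finite {k. f k \<noteq> 0}" "\<And>k. f k \<in> so n" "\<And>k i j. f k i j \<noteq> 0 \<Longrightarrow> (k, i, j) \<in> pos_cells"
    using insert.prems(2) by (rule element_cases) blast
  have part: "weight_part n \<alpha> x \<in> I" if \<alpha>: "\<alpha> \<in> \<Lambda>" for \<alpha>
  proof -
    have "\<alpha> \<noteq> \<beta>"
      using \<alpha> insert.hyps by blast
    then obtain h where h: "\<alpha> h \<noteq> \<beta> h"
      unfolding fun_eq_iff by blast
    have "h \<in> aff_cartan n"
    proof (rule ccontr)
      assume "h \<notin> aff_cartan n"
      moreover have "\<alpha> \<in> range (cell_weight n)" "\<beta> \<in> range (cell_weight n)"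
        using \<alpha> insert.prems(1) by auto
      ultimately have "\<alpha> h = 0" "\<beta> h = 0"
        by (auto simp: cell_weight_def)
      with h show False by simp
    qed
    let ?y = "aff_bracket n h x - aff_scale (\<beta> h) x"
    have y: "?y = ((\<lambda>k i j. (cell_weight n (k, i, j) h - \<beta> h) * f k i j), 0, 0)"
      unfolding f(1) aff_bracket_cell[OF \<open>h \<in> aff_cartan n\<close> f(3)]
      by (simp add: aff_scale_simp mat_scale_def fun_eq_iff zero_prod_def algebra_simps)
    have "aff_bracket n h x \<in> I"
      using \<open>h \<in> aff_cartan n\<close> aff_cartan_borel insert.prems(2) ideal by blast
    then have "?y \<in> I"
      using insert.prems(2) subspace by (intro aff.subspace_diff aff.subspace_scale)
    moreover have "cell_weight n (k, i, j) \<in> \<Lambda>" if "fst ?y k i j \<noteq> 0" for k i j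
      using that insert.prems(3)[of k i j] unfolding y by (auto simp: f(1))
    ultimately have "weight_part n \<alpha> ?y \<in> I"
      using insert.IH[of ?y \<alpha>] insert.prems(1) \<alpha> by auto
    moreover have "weight_part n \<alpha> ?y = aff_scale (\<alpha> h - \<beta> h) (weight_part n \<alpha> x)"
      unfolding weight_part_def y by (auto simp: f(1) aff_scale_simp mat_scale_def intro!: ext)
    ultimately have "aff_scale (inverse (\<alpha> h - \<beta> h)) (aff_scale (\<alpha> h - \<beta> h) (weight_part n \<alpha> x)) \<in> I"
      using subspace by (metis aff.subspace_scale)
    then show ?thesis
      using h by simp
  qed
  have "(\<lambda>k i j. if cell_weight n (k, i, j) \<in> insert \<beta> \<Lambda> then fst x k i j else 0) = f"
  proof (intro ext)
    fix k i j
    show "(if cell_weight n (k, i, j) \<in> insert \<beta> \<Lambda> then fst x k i j else 0) = f k i j"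
      using insert.prems(3)[of k i j] by (cases "f k i j = 0") (simp_all add: f(1))
  qed
  then have "x = (\<Sum>\<alpha>\<in>insert \<beta> \<Lambda>. weight_part n \<alpha> x)"
    unfolding sum_weight_part[OF finite.insertI[OF insert.hyps(1)]] by (simp add: f(1))
  also have "\<dots> = weight_part n \<beta> x + (\<Sum>\<alpha>\<in>\<Lambda>. weight_part n \<alpha> x)"
    using insert.hyps by simp
  \<comment> \<open>The part of weight \<beta> is what remains after the parts for \<Lambda> are
    removed.\<close>
  finally have "weight_part n \<beta> x = x - (\<Sum>\<alpha>\<in>\<Lambda>. weight_part n \<alpha> x)"
    by (simp add: eq_diff_eq)
  moreover have "x - (\<Sum>\<alpha>\<in>\<Lambda>. weight_part n \<alpha> x) \<in> I"
    using subspace insert.prems(2) part by (intro aff.subspace_diff aff.subspace_sum)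
  ultimately show ?case
    using part insert.prems(4) by auto
qed simp

lemma finite_weights:
  assumes "finite {k. f k \<noteq> 0}" "\<And>k. f k \<in> so n"
  shows "finite (cell_weight n ` {(k, i, j). f k i j \<noteq> 0})"
proof -
  have "finite ({k. f k \<noteq> 0} \<times> {- int n..int n} \<times> {- int n..int n})"
    using assms(1) by simp
  moreover have "{(k, i, j). f k i j \<noteq> 0} \<subseteq> {k. f k \<noteq> 0} \<times> {- int n..int n} \<times> {- int n..int n}"
    using so_nonzero(1,2)[OF assms(2)] by (fastforce simp: abs_le_iff)
  ultimately show ?thesis
    by (metis finite_imageI finite_subset)
qed

lemma weight_decomposition:
  assumes "finite {k. f k \<noteq> 0}" "\<And>k. f k \<in> so n"
  shows "(f, 0, 0) = (\<Sum>\<alpha>\<in>cell_weight n ` {(k, i, j). f k i j \<noteq> 0}. weight_part n \<alpha> (f, 0, 0))"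
  unfolding sum_weight_part[OF finite_weights[OF assms]] by (auto simp: fun_eq_iff)

lemma weight_part_mem:
  assumes "x \<in> I" "fst x k i j \<noteq> 0"
  shows "weight_part n (cell_weight n (k, i, j)) x \<in> I"
proof -
  obtain f where f: "x = (f, 0, 0)" "finite {k. f k \<noteq> 0}" "\<And>k. f k \<in> so n" "\<And>k i j. f k i j \<noteq> 0 \<Longrightarrow> (k, i, j) \<in> pos_cells"
    using assms(1) by (rule element_cases) blast
  show ?thesis
    by (rule weight_part_finite[OF finite_weights[OF f(2,3)]]) (use assms f(1) in auto)
qed

end

section \<open>Supports of combinatorial ideals\<close>

lemma tensor_apply: "fst (tensor_t A k) m = (if m = k then A else 0)"
  by (simp add: tensor_t_def)

lemma aff_bracket_tensor: "fst (aff_bracket n (tensor_t A k) (tensor_t B l)) (k + l) = mat_bracket n A B"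
proof (cases "A = 0")
  case True
  show ?thesis
    unfolding True by (simp add: tensor_t_def aff_bracket_def mat_scale_def fun_eq_iff)
next
  case False
  then have "{m. (if m = k then A else 0) \<noteq> 0} = {k}"
    by auto
  then show ?thesis
    by (simp add: tensor_t_def aff_bracket_def mat_scale_def zero_fun_def[symmetric])
qed

lemma tensor_unit_borel:
  assumes "(k, p, q) \<in> pos_cells" "\<bar>p\<bar> \<le> int n" "\<bar>q\<bar> \<le> int n"
  shows "tensor_t (unit_mat p q) k \<in> aff_borel n"
proof -
  have "tensor_t (unit_mat p q) k \<in> aff_nilp n"
    unfolding aff_nilp_coord using assms by (intro tensor_unit_coord_space) (auto simp: pos_cells_def)
  then show ?thesis
    using aff_nilp_borel by blast
qed

locale comb_ideal = graded_ideal +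
  assumes root_spaces: "\<And>\<alpha>. \<alpha> \<in> aff_pos_roots n \<Longrightarrow> I \<inter> aff_root_space n \<alpha> \<in> {{0}, aff_root_space n \<alpha>}"
begin

text \<open>Cells are used instead of weights, so that bracket computations become moves of matrix
  positions.\<close>

definition support :: "(int \<times> int \<times> int) set" where
  "support = {(k, i, j). \<exists>x\<in>I. fst x k i j \<noteq> 0}"

lemma support_cell:
  assumes "(k, i, j) \<in> support"
  shows "\<bar>i\<bar> \<le> int n" "\<bar>j\<bar> \<le> int n" "i \<noteq> - j" "(k, i, j) \<in> pos_cells" "(k, - j, - i) \<in> support"
proof -
  obtain x where x: "x \<in> I" "fst x k i j \<noteq> 0"
    using assms by (auto simp: support_def)
  obtain f where f: "x = (f, 0, 0)" "finite {k. f k \<noteq> 0}" "\<And>k. f k \<in> so n"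
    "\<And>k i j. f k i j \<noteq> 0 \<Longrightarrow> (k, i, j) \<in> pos_cells"
    using x(1) by (rule element_cases) blast
  show "\<bar>i\<bar> \<le> int n" "\<bar>j\<bar> \<le> int n" "i \<noteq> - j" "(k, i, j) \<in> pos_cells"
    using x(2) so_nonzero[OF f(3), of k i j] f(4)[of k i j] unfolding f(1) by auto
  have "fst x k (- j) (- i) \<noteq> 0"
    using x(2) so_nonzero(4)[OF f(3), of k i j] unfolding f(1) by auto
  then show "(k, - j, - i) \<in> support"
    using x(1) unfolding support_def by blast
qed

text \<open>The weight component of an element that is nonzero at the cell is a nonzero vector of I
  in this root space, so the alternative in \<open>root_spaces\<close> leaves only the full root
  space.\<close>

lemma support_root_space:
  assumes "(k, i, j) \<in> support"
  shows "aff_root_space n (cell_weight n (k, i, j)) \<subseteq> I"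
proof -
  let ?\<alpha> = "cell_weight n (k, i, j)"
  obtain x where x: "x \<in> I" "fst x k i j \<noteq> 0"
    using assms by (auto simp: support_def)
  let ?y = "weight_part n ?\<alpha> x"
  have y: "?y \<in> I" "?y \<in> aff_root_space n ?\<alpha>"
    using weight_part_mem[OF x] weight_part_root_space x(1) nilp by blast+
  have "fst ?y k i j \<noteq> 0"
    using x(2) by (simp add: weight_part_def)
  then have nz: "?y \<noteq> 0"
    by (metis fst_zero zero_fun_apply)
  have "?\<alpha> \<in> aff_pos_roots n"
    using support_cell[OF assms] y(2) nz by (intro pos_cell_weight)
  from root_spaces[OF this] show ?thesis
    using y nz by blast
qed

lemma unit_mem:
  assumes "(k, i, j) \<in> support"
  shows "tensor_t (unit_mat i j) k \<in> I"
  using support_root_space[OF assms] tensor_unit_root_space[OF support_cell(1,2)[OF assms]] by blast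

lemma supportI: "x \<in> I \<Longrightarrow> fst x k i j \<noteq> 0 \<Longrightarrow> (k, i, j) \<in> support"
  unfolding support_def by blast

lemma bracket_support:
  assumes "tensor_t A k \<in> aff_borel n" "tensor_t B l \<in> I" "mat_bracket n A B i j \<noteq> 0"
  shows "(k + l, i, j) \<in> support"
  using ideal[OF assms(1,2)] assms(3) by (intro supportI) (auto simp: aff_bracket_tensor)

lemma unit_support:
  assumes "tensor_t (unit_mat i j) k \<in> I" "i \<noteq> - j"
  shows "(k, i, j) \<in> support"
  using assms by (intro supportI[OF assms(1)]) (auto simp: tensor_apply unit_mat_def)

text \<open>The bracket with \<open>unit_mat r p\<close> moves an entry from row p to row r. The
  last two inequalities keep the multiplier and the target off the antidiagonal, where
  \<open>so n\<close> vanishes.\<close>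

lemma support_left:
  assumes "(l, p, q) \<in> support" "p \<noteq> q" "(k, r, p) \<in> pos_cells" "\<bar>r\<bar> \<le> int n" "r \<noteq> - p" "r \<noteq> - q"
  shows "(k + l, r, q) \<in> support"
proof (rule bracket_support)
  show "tensor_t (unit_mat r p) k \<in> aff_borel n"
    using assms support_cell[OF assms(1)] by (intro tensor_unit_borel)
  show "tensor_t (unit_mat p q) l \<in> I"
    using assms(1) by (rule unit_mem)
  have "mat_bracket n (unit_mat r p) (unit_mat p q) r q = 1"
    using support_cell(1-3)[OF assms(1)] assms(2,5,6) by (intro unit_mat_bracket) auto
  then show "mat_bracket n (unit_mat r p) (unit_mat p q) r q \<noteq> 0"
    by simp
qed

lemma support_right:
  assumes "(l, p, q) \<in> support" "p \<noteq> q" "(k, q, s) \<in> pos_cells" "\<bar>s\<bar> \<le> int n" "s \<noteq> - q" "s \<noteq> - p"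
  shows "(k + l, p, s) \<in> support"
proof -
  have "(k + l, - s, - p) \<in> support"
    using assms support_cell(5)[OF assms(1)] by (intro support_left[of l "- q" "- p"]) (auto simp: pos_cells_def)
  then show ?thesis
    using support_cell(5)[of "k + l" "- s" "- p"] by simp
qed

text \<open>The diagonal cells of degree l all belong to one root space, so one of them brings in
  the others. Row 0 is excluded because its diagonal entry lies on the antidiagonal.\<close>

lemma support_diag:
  assumes "(l, p, p) \<in> support" "\<bar>r\<bar> \<le> int n" "r \<noteq> 0"
  shows "(l, r, r) \<in> support" "tensor_t (unit_mat r r) l \<in> I"
proof -
  have "tensor_t (unit_mat r r) l \<in> aff_root_space n (cell_weight n (l, p, p))"
    using tensor_unit_root_space[OF assms(2,2), of l] cell_weight_diag[of n l p r] by simp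
  then show *: "tensor_t (unit_mat r r) l \<in> I"
    using support_root_space[OF assms(1)] by blast
  show "(l, r, r) \<in> support"
    using * assms(3) by (intro unit_support) auto
qed

lemma support_diag_root:
  assumes "(l, p, p) \<in> support" "(k, r, s) \<in> pos_cells" "\<bar>r\<bar> \<le> int n" "\<bar>s\<bar> \<le> int n" "r \<noteq> s" "r \<noteq> - s"
  shows "(k + l, r, s) \<in> support"
proof -
  \<comment> \<open>Chosen so that the root at (r, s) does not vanish on
    \<open>unit_mat u u\<close>, which would be zero for u = 0.\<close>
  define u where "u = (if r \<noteq> 0 then r else s)"
  have u: "\<bar>u\<bar> \<le> int n" "u \<noteq> 0"
    using assms by (auto simp: u_def)
  show ?thesis
  proof (rule bracket_support)
    show "tensor_t (unit_mat r s) k \<in> aff_borel n"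
      using assms by (intro tensor_unit_borel)
    show "tensor_t (unit_mat u u) l \<in> I"
      using support_diag(2)[OF assms(1) u] .
    have "mat_bracket n (unit_mat r s) (unit_mat u u) r s = - ((unit_mat u u r r - unit_mat u u s s) * unit_mat r s r s)"
      unfolding mat_bracket_flip[of n "unit_mat r s"]
      by (subst mat_bracket_cartan[OF unit_mat_cartan unit_mat_so]) (use assms u in auto)
    then show "mat_bracket n (unit_mat r s) (unit_mat u u) r s \<noteq> 0"
      using assms by (auto simp: u_def unit_mat_def)
  qed
qed

text \<open>An element with entries in the support is a sum of weight components, and each lies in a
  root space contained in I. So I is determined by its support.\<close>

lemma eq_coord_space: "I = coord_space n support"
proof
  show "I \<subseteq> coord_space n support"
  proof
    fix x assume x: "x \<in> I"
    obtain f where f: "x = (f, 0, 0)" "finite {k. f k \<noteq> 0}" "\<And>k. f k \<in> so n"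
      "\<And>k i j. f k i j \<noteq> 0 \<Longrightarrow> (k, i, j) \<in> pos_cells"
      using x by (rule element_cases) blast
    show "x \<in> coord_space n support"
      using f supportI[OF x] by (auto simp: coord_space_def)
  qed
  show "coord_space n support \<subseteq> I"
  proof
    fix x assume x: "x \<in> coord_space n support"
    then obtain f where f: "x = (f, 0, 0)" "finite {k. f k \<noteq> 0}" "\<And>k. f k \<in> so n"
      "\<And>k i j. f k i j \<noteq> 0 \<Longrightarrow> (k, i, j) \<in> support"
      unfolding coord_space_def by auto
    have "x \<in> coord_space n pos_cells"
      using f support_cell(4) by (auto simp: coord_space_def)
    then have nilp: "x \<in> aff_nilp n"
      by (simp add: aff_nilp_coord)
    have "(\<Sum>\<alpha>\<in>cell_weight n ` {(k, i, j). f k i j \<noteq> 0}. weight_part n \<alpha> x) \<in> I"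
    proof (rule aff.subspace_sum[OF subspace])
      fix \<alpha> assume "\<alpha> \<in> cell_weight n ` {(k, i, j). f k i j \<noteq> 0}"
      then obtain k i j where "f k i j \<noteq> 0" "\<alpha> = cell_weight n (k, i, j)"
        by auto
      then show "weight_part n \<alpha> x \<in> I"
        using weight_part_root_space[OF nilp, of \<alpha>] support_root_space[of k i j] f(4) by blast
    qed
    then show "x \<in> I"
      using weight_decomposition[OF f(2,3)] f(1) by simp
  qed
qed

lemma support_above_delta:
  assumes n: "n \<ge> 1" and d: "(1, p, p) \<in> support"
    and k: "k \<ge> 2 \<or> k = 1 \<and> i \<le> j" and ij: "\<bar>i\<bar> \<le> int n" "\<bar>j\<bar> \<le> int n" "i \<noteq> - j"
  shows "(k, i, j) \<in> support"
proof (cases "i = j")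
  case False
  have "((k - 1) + 1, i, j) \<in> support"
    using k ij False by (intro support_diag_root[OF d]) (auto simp: pos_cells_def)
  then show ?thesis by simp
next
  case True
  then have "i \<noteq> 0"
    using ij by auto
  show ?thesis
  proof (cases "k = 1")
    case True
    then show ?thesis
      using support_diag(1)[OF d ij(1) \<open>i \<noteq> 0\<close>] \<open>i = j\<close> by simp
  next
    case False
    \<comment> \<open>Diagonal matrices commute, so the diagonal in degree k is reached by way of
      the root position (0, 1).\<close>
    have "(0 + 1, 0, 1) \<in> support"
      using n by (intro support_diag_root[OF d]) (auto simp: pos_cells_def)
    then have "((k - 1) + 1, 1, 1) \<in> support"
      using k False n by (intro support_left[of 1 0 1]) (auto simp: pos_cells_def)
    then show ?thesis
      using support_diag(1)[of k 1 i] ij(1) \<open>i \<noteq> 0\<close> \<open>i = j\<close> by simp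
  qed
qed

text \<open>A root \<open>\<gamma>\<close> and \<open>\<delta> - \<gamma>\<close> both lie below \<open>\<delta>\<close>.\<close>

lemma support_delta:
  assumes pq: "p < q" "p \<noteq> - q" "\<bar>p\<bar> \<le> int n" "\<bar>q\<bar> \<le> int n"
    and S: "(0, p, q) \<in> support \<or> (1, q, p) \<in> support"
  shows "\<exists>r. (1, r, r) \<in> support"
  using S
proof
  assume S: "(0, p, q) \<in> support"
  show ?thesis
  proof (cases "q = 0")
    case False
    then have "(1 + 0, q, q) \<in> support"
      using pq by (intro support_left[OF S]) (auto simp: pos_cells_def)
    then show ?thesis by auto
  next
    \<comment> \<open>The entry at (0, 0) vanishes in \<open>so n\<close>, so the entry at (p, p) is
      used instead.\<close>
    case True
    then have "(1 + 0, p, p) \<in> support"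
      using pq by (intro support_right[OF S]) (auto simp: pos_cells_def)
    then show ?thesis by auto
  qed
next
  assume S: "(1, q, p) \<in> support"
  show ?thesis
  proof (cases "p = 0")
    case False
    then have "(0 + 1, p, p) \<in> support"
      using pq by (intro support_left[OF S]) (auto simp: pos_cells_def)
    then show ?thesis by auto
  next
    case True
    then have "(0 + 1, q, q) \<in> support"
      using pq by (intro support_right[OF S]) (auto simp: pos_cells_def)
    then show ?thesis by auto
  qed
qed

end

lemma comb_idealI: "combinatorial_ideal n I \<Longrightarrow> comb_ideal n I"
  by unfold_locales (auto simp: combinatorial_ideal_def borel_ideal_def)

section \<open>Presence of \<delta> in basic ideals\<close>

text \<open>Any nonzero entry of a root vector determines the root through the diagonal action, and
  strict upper triangularity gives p < q.\<close>

lemma fin_pos_root_cell: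
  assumes "\<gamma> \<in> fin_pos_roots n"
  obtains p q where "p < q" "p \<noteq> - q" "\<bar>p\<bar> \<le> int n" "\<bar>q\<bar> \<le> int n"
    "\<And>h. h \<in> cartan n \<Longrightarrow> \<gamma> h = h p p - h q q"
proof -
  have ne: "fin_root_space n \<gamma> \<noteq> {0}" and sub: "fin_root_space n \<gamma> \<subseteq> nilp n"
    using assms by (auto simp: fin_pos_roots_def roots_def fin_root_space_def)
  have "0 \<in> fin_root_space n \<gamma>"
    by (simp add: fin_root_space_def weight_space_def so_zero)
  with ne obtain y where y: "y \<in> fin_root_space n \<gamma>" "y \<noteq> 0"
    by blast
  then obtain p q where pq: "y p q \<noteq> 0"
    by (auto simp: fun_eq_iff)
  have yso: "y \<in> so n" and lt: "p < q"
    using y(1) sub pq by (auto simp: nilp_def)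
  show ?thesis
  proof
    show "p < q" "p \<noteq> - q" "\<bar>p\<bar> \<le> int n" "\<bar>q\<bar> \<le> int n"
      using lt so_nonzero[OF yso pq] by auto
    fix h assume h: "h \<in> cartan n"
    have "mat_bracket n h y = mat_scale (\<gamma> h) y"
      using y(1) h by (simp add: fin_root_space_def weight_space_def)
    then have "(h p p - h q q) * y p q = \<gamma> h * y p q"
      using mat_bracket_cartan[OF h yso] by (simp add: mat_scale_def fun_eq_iff)
    then show "\<gamma> h = h p p - h q q"
      using pq by simp
  qed
qed

text \<open>The three kinds of basic roots are the weights of cells (1, 1, 1), (0, p, q) and (1, q,
  p) with p < q; the last two lead to a diagonal cell by \<open>support_delta\<close>.\<close>

lemma basic_ideal_delta:
  assumes n: "n \<ge> 1" and I: "basic_ideal n I"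
  shows "\<exists>r. (1, r, r) \<in> comb_ideal.support I"
proof -
  interpret comb_ideal n I
    using I by (intro comb_idealI) (simp add: basic_ideal_def)
  obtain \<alpha> where \<alpha>: "\<alpha> \<in> supp n I" "\<alpha> \<in> basic_roots n"
    using I by (auto simp: basic_ideal_def)
  have sub: "aff_root_space n \<alpha> \<subseteq> I"
    using \<alpha>(1) by (simp add: supp_def)
  consider "\<alpha> = delta n" | \<gamma> where "\<gamma> \<in> fin_pos_roots n" "\<alpha> = extend_root n \<gamma>"
    | \<gamma> where "\<gamma> \<in> fin_pos_roots n" "\<alpha> = delta n - extend_root n \<gamma>"
    using \<alpha>(2) by (auto simp: basic_roots_def Let_def)
  then show ?thesis
  proof cases
    case 1
    then have "tensor_t (unit_mat 1 1) 1 \<in> I"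
      using sub tensor_unit_root_space[of 1 n 1 1] n delta_cell_weight[of n 1] by auto
    then have "(1, 1, 1) \<in> support"
      by (rule unit_support) simp
    then show ?thesis ..
  next
    case 2
    obtain p q where pq: "p < q" "p \<noteq> - q" "\<bar>p\<bar> \<le> int n" "\<bar>q\<bar> \<le> int n"
      "\<And>h. h \<in> cartan n \<Longrightarrow> \<gamma> h = h p p - h q q"
      using 2(1) by (rule fin_pos_root_cell) blast
    have "\<alpha> = cell_weight n (0, p, q)"
      unfolding 2(2) using pq(5) by (auto simp: extend_root_def cell_weight_def aff_cartan_explicit intro!: ext)
    then have "tensor_t (unit_mat p q) 0 \<in> I"
      using sub tensor_unit_root_space[OF pq(3,4), of 0] by auto
    then have "(0, p, q) \<in> support"
      using pq(2) by (rule unit_support)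
    then show ?thesis
      using support_delta[OF pq(1-4)] by blast
  next
    case 3
    obtain p q where pq: "p < q" "p \<noteq> - q" "\<bar>p\<bar> \<le> int n" "\<bar>q\<bar> \<le> int n"
      "\<And>h. h \<in> cartan n \<Longrightarrow> \<gamma> h = h p p - h q q"
      using 3(1) by (rule fin_pos_root_cell) blast
    have "\<alpha> = cell_weight n (1, q, p)"
      unfolding 3(2) using pq(5)
      by (auto simp: extend_root_def delta_def cell_weight_def aff_cartan_explicit intro!: ext)
    then have "tensor_t (unit_mat q p) 1 \<in> I"
      using sub tensor_unit_root_space[OF pq(4,3), of 1] by auto
    then have "(1, q, p) \<in> support"
      using pq(2) by (intro unit_support) auto
    then show ?thesis
      using support_delta[OF pq(1-4)] by blast
  qed
qed

section \<open>Basic ideals and pairs of upper sets\<close>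

text \<open>The cell \<open>(i, j)\<close> of an upper set stands for the positive root at the matrix positions
  \<open>(- i, j)\<close> and \<open>(- j, i)\<close>.\<close>

definition positions :: "(int \<times> int) set \<Rightarrow> (int \<times> int) set" where
  "positions X = {(p, q). p + q < 0 \<and> (- p, q) \<in> X \<or> p + q > 0 \<and> (q, - p) \<in> X}"

lemma positions_mirror: "(- q, - p) \<in> positions X \<longleftrightarrow> (p, q) \<in> positions X"
  by (auto simp: positions_def)

lemma positions_lower: "j < i \<Longrightarrow> (- i, j) \<in> positions X \<longleftrightarrow> (i, j) \<in> X"
  by (auto simp: positions_def)

lemma positions_upper: "j < i \<Longrightarrow> (- j, i) \<in> positions X \<longleftrightarrow> (i, j) \<in> X"
  by (auto simp: positions_def)

lemma positions_bounds:
  assumes "X \<in> upper_sets n" "(p, q) \<in> positions X"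
  shows "p < q" "- int n \<le> p" "q \<le> int n" "p \<noteq> - q"
  using assms(2) upper_sets_cells[OF assms(1), of "- p" q] upper_sets_cells[OF assms(1), of q "- p"]
  by (auto simp: positions_def)

text \<open>Moving up within a column raises the root. When the antidiagonal is crossed, q changes
  from the first to the second coordinate of the cell.\<close>

lemma positions_left:
  assumes X: "X \<in> upper_sets n" and pq: "(p, q) \<in> positions X" and r: "r \<le> p" "- int n \<le> r" "r \<noteq> - q"
  shows "(r, q) \<in> positions X"
proof -
  note b = positions_bounds[OF X pq]
  consider "p + q < 0" "(- p, q) \<in> X" | "p + q > 0" "(q, - p) \<in> X"
    using pq by (auto simp: positions_def)
  then show ?thesis
  proof cases
    case 1
    then have "(- r, q) \<in> X"
      using r b by (intro upper_setsD[OF X 1(2)]) auto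
    then show ?thesis
      using 1 r by (auto simp: positions_def)
  next
    case 2
    show ?thesis
    proof (cases "r + q < 0")
      case True
      then have "(- r, q) \<in> X"
        using r b 2(1) by (intro upper_setsD[OF X 2(2)]) auto
      then show ?thesis
        using True by (auto simp: positions_def)
    next
      case False
      then have "(q, - r) \<in> X"
        using r b by (intro upper_setsD[OF X 2(2)]) auto
      then show ?thesis
        using False r by (auto simp: positions_def)
    qed
  qed
qed

lemma positions_right:
  assumes X: "X \<in> upper_sets n" and pq: "(p, q) \<in> positions X" and s: "q \<le> s" "s \<le> int n" "s \<noteq> - p"
  shows "(p, s) \<in> positions X"
proof -
  have "(- s, - p) \<in> positions X"
    by (rule positions_left[OF X, of "- q" "- p"]) (use s pq in \<open>auto simp: positions_mirror\<close>)
  then show ?thesis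
    by (simp add: positions_mirror)
qed

text \<open>From composable positions (p, q) and (q, s), moving p up to row -(n - 1) and s right to
  column n would produce a pair excluded by \<open>commuting\<close>.\<close>

lemma positions_commute:
  assumes A: "A \<in> upper_sets n" and C: "C \<in> upper_sets n" and com: "commuting n A C"
    and pq: "(p, q) \<in> positions A" and qs: "(q, s) \<in> positions C" and ps: "p \<noteq> - s"
  shows False
proof -
  have key: False
    if A: "A \<in> upper_sets n" and C: "C \<in> upper_sets n" and com: "commuting n A C"
      and pq: "(p, q) \<in> positions A" and qs: "(q, s) \<in> positions C" and p: "p > - int n"
    for A C p q s
  proof -
    note b = positions_bounds[OF A pq] positions_bounds[OF C qs]
    show False
    proof (cases "q = int n - 1")
      case True
      then have s: "s = int n"
        using b by auto
      have p': "\<bar>- p\<bar> \<le> int n - 2"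
        using b p True by auto
      have "(int n - 1, - p) \<in> A"
        using pq b p True by (auto simp: positions_def)
      moreover have low: "(int n, - (int n - 1)) \<in> C"
        using qs b p' unfolding True s by (auto simp: positions_def)
      have "(int n, - (- p)) \<in> C"
        using p' by (intro upper_setsD[OF C low]) auto
      ultimately show False
        using com p' unfolding commuting_def by blast
    next
      case False
      then have q: "\<bar>q\<bar> \<le> int n - 2"
        using b p by auto
      have "(- (int n - 1), q) \<in> positions A"
        by (rule positions_left[OF A pq]) (use p q in auto)
      then have "(int n - 1, q) \<in> A"
        using q positions_lower[of q "int n - 1" A] by auto
      moreover have "(q, int n) \<in> positions C"
        by (rule positions_right[OF C qs]) (use b q in auto)
      then have "(int n, - q) \<in> C"
        using q positions_upper[of "- q" "int n" C] by auto
      ultimately show False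
        using com q unfolding commuting_def by blast
    qed
  qed
  have com': "commuting n C A"
    unfolding commuting_def
  proof (intro allI impI)
    fix j assume "\<bar>j\<bar> \<le> int n - 2"
    then show "\<not> ((int n - 1, j) \<in> C \<and> (int n, - j) \<in> A) \<and> \<not> ((int n, - j) \<in> C \<and> (int n - 1, j) \<in> A)"
      using com unfolding commuting_def by blast
  qed
  show False
  proof (cases "p > - int n")
    case True
    then show False
      by (rule key[OF A C com pq qs])
  next
    \<comment> \<open>Now p = -n and therefore s < n. The mirror image exchanges the two factors and
      leads back to the first case.\<close>
    case False
    then have "- s > - int n"
      using positions_bounds[OF A pq] positions_bounds[OF C qs] ps by auto
    then show False
      using pq qs by (intro key[OF C A com', of "- s" "- q" "- p"]) (simp_all add: positions_mirror)
  qed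
qed

section \<open>Ideals built from pairs of upper sets\<close>

text \<open>Off the antidiagonal, the cells with k = 1 and i \<le> j have weights \<delta> and
  \<delta> + \<gamma>, and those with j < i have weight \<delta> - \<gamma> for the root \<gamma> at
  (j, i); C records the \<gamma> for which the latter is missing.\<close>

definition pair_cells :: "(int \<times> int) set \<Rightarrow> (int \<times> int) set \<Rightarrow> (int \<times> int \<times> int) set" where
  "pair_cells A C = {(k, i, j). k \<ge> 2 \<or> k = 1 \<and> (i \<le> j \<or> (j, i) \<notin> positions C) \<or> k = 0 \<and> (i, j) \<in> positions A}"

lemma pair_cells_mirror: "(k, - j, - i) \<in> pair_cells A C \<longleftrightarrow> (k, i, j) \<in> pair_cells A C"
  using positions_mirror[of j i A] positions_mirror[of i j C] by (auto simp: pair_cells_def)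

lemma coord_space_fst: "x \<in> coord_space n S \<Longrightarrow> fst x k i j \<noteq> 0 \<Longrightarrow> (k, i, j) \<in> S"
  by (auto simp: coord_space_def)

lemma tensor_unit_pair_cells:
  assumes "\<bar>p\<bar> \<le> int n" "\<bar>q\<bar> \<le> int n" "p \<noteq> - q"
  shows "tensor_t (unit_mat p q) k \<in> coord_space n (pair_cells A C) \<longleftrightarrow> (k, p, q) \<in> pair_cells A C"
proof
  assume "tensor_t (unit_mat p q) k \<in> coord_space n (pair_cells A C)"
  then show "(k, p, q) \<in> pair_cells A C"
    by (rule coord_space_fst) (use assms in \<open>auto simp: tensor_apply unit_mat_def\<close>)
next
  assume "(k, p, q) \<in> pair_cells A C"
  then show "tensor_t (unit_mat p q) k \<in> coord_space n (pair_cells A C)"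
    using assms by (intro tensor_unit_coord_space) (auto simp: pair_cells_mirror)
qed

text \<open>Off the antidiagonal a cell is detected by its unit tensor; the positions (-i, j) in
  degree 0 and (j, -i) in degree 1 recover A and C.\<close>

lemma coord_space_pair_cells_inj:
  assumes "A \<in> upper_sets n" "C \<in> upper_sets n" "A' \<in> upper_sets n" "C' \<in> upper_sets n"
    and eq: "coord_space n (pair_cells A C) = coord_space n (pair_cells A' C')"
  shows "A = A' \<and> C = C'"
proof -
  have "((i, j) \<in> A \<longleftrightarrow> (i, j) \<in> A') \<and> ((i, j) \<in> C \<longleftrightarrow> (i, j) \<in> C')" for i j
  proof (cases "1 \<le> i \<and> i \<le> int n \<and> \<bar>j\<bar> < i")
    case True
    then have "(0, - i, j) \<in> pair_cells A C \<longleftrightarrow> (0, - i, j) \<in> pair_cells A' C'"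
      "(1, j, - i) \<in> pair_cells A C \<longleftrightarrow> (1, j, - i) \<in> pair_cells A' C'"
      unfolding atomize_conj using True eq
      by (subst (1 2) tensor_unit_pair_cells[of "- i" n j 0, symmetric],
          auto simp flip: tensor_unit_pair_cells[of j n "- i" 1])
    then show ?thesis
      using True by (auto simp: pair_cells_def positions_lower)
  next
    case False
    then show ?thesis
      using assms(1-4) upper_sets_cells by blast
  qed
  then show ?thesis by auto
qed

lemma pair_cells_pos:
  assumes "A \<in> upper_sets n"
  shows "pair_cells A C \<subseteq> pos_cells"
  using positions_bounds[OF assms] by (auto simp: pair_cells_def pos_cells_def)

text \<open>In total degree 0 this is the upper set property of A. In total degree 1 it is the upper
  set property of C for a multiplier of degree 0, and the commuting condition for one of degree
  1.\<close>

lemma pair_cells_left: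
  assumes A: "A \<in> upper_sets n" and C: "C \<in> upper_sets n" and com: "commuting n A C"
    and l: "(l, p, j) \<in> pair_cells A C" and k: "k > 0 \<or> k = 0 \<and> i \<le> p"
    and b: "\<bar>i\<bar> \<le> int n" "\<bar>p\<bar> \<le> int n" "p \<noteq> - j" "i \<noteq> - j" "i \<noteq> - p"
  shows "(k + l, i, j) \<in> pair_cells A C"
proof -
  have "l \<ge> 0"
    using l by (auto simp: pair_cells_def)
  then have "k + l \<ge> 2 \<or> k = 1 \<and> l = 0 \<or> k = 0 \<and> l = 1 \<or> k = 0 \<and> l = 0"
    using k by linarith
  then consider "k + l \<ge> 2" | "k = 1" "l = 0" | "k = 0" "l = 1" | "k = 0" "l = 0"
    by blast
  then show ?thesis
  proof cases
    case 1
    then show ?thesis by (simp add: pair_cells_def)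
  next
    case 2
    then have "(p, j) \<in> positions A"
      using l by (simp add: pair_cells_def)
    then have "(j, i) \<notin> positions C"
      using positions_commute[OF A C com, of p j i] b(5) by auto
    then show ?thesis
      using 2 by (simp add: pair_cells_def)
  next
    case 3
    have "(j, i) \<notin> positions C" if "j < i"
    proof
      assume ji: "(j, i) \<in> positions C"
      have "(j, p) \<in> positions C"
        by (rule positions_right[OF C ji]) (use 3 k b in auto)
      then show False
        using l 3 k that by (auto simp: pair_cells_def)
    qed
    then show ?thesis
      using 3 by (auto simp: pair_cells_def)
  next
    case 4
    have "(i, j) \<in> positions A"
      by (rule positions_left[OF A, of p j]) (use 4 l k b in \<open>auto simp: pair_cells_def\<close>)
    then show ?thesis
      using 4 by (simp add: pair_cells_def)
  qed
qed

lemma pair_cells_right: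
  assumes A: "A \<in> upper_sets n" and C: "C \<in> upper_sets n" and com: "commuting n A C"
    and l: "(l, i, p) \<in> pair_cells A C" and k: "k > 0 \<or> k = 0 \<and> p \<le> j"
    and b: "\<bar>j\<bar> \<le> int n" "\<bar>p\<bar> \<le> int n" "i \<noteq> - p" "i \<noteq> - j" "p \<noteq> - j"
  shows "(k + l, i, j) \<in> pair_cells A C"
proof -
  have "(k + l, - j, - i) \<in> pair_cells A C"
    by (rule pair_cells_left[OF A C com, of l "- p"]) (use l k b in \<open>auto simp: pair_cells_mirror\<close>)
  then show ?thesis
    by (simp add: pair_cells_mirror)
qed

lemma coord_space_ideal:
  assumes A: "A \<in> upper_sets n" and C: "C \<in> upper_sets n" and com: "commuting n A C"
    and x: "x \<in> aff_borel n" and y: "y \<in> coord_space n (pair_cells A C)"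
  shows "aff_bracket n x y \<in> coord_space n (pair_cells A C)"
proof -
  let ?S = "pair_cells A C"
  obtain f a b where f: "x = (f, a, b)" "finite {k. f k \<noteq> 0}" "\<And>k. f k \<in> so n"
    "\<And>k i j. f k i j \<noteq> 0 \<Longrightarrow> k > 0 \<or> k = 0 \<and> i \<le> j"
    using x by (rule aff_borel_cases) blast
  obtain g where g: "y = (g, 0, 0)" "finite {k. g k \<noteq> 0}" "\<And>k. g k \<in> so n"
    "\<And>k i j. g k i j \<noteq> 0 \<Longrightarrow> (k, i, j) \<in> ?S"
    using y unfolding coord_space_def by auto
  define h where "h = (\<lambda>m. (\<Sum>k | f k \<noteq> 0. mat_bracket n (f k) (g (m - k))) + mat_scale (b * of_int m) (g m))"
  \<comment> \<open>The central term vanishes: all degrees are nonnegative, and degree 0 has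
    coefficient 0.\<close>
  have "of_int k * killing n (f k) (g (- k)) = 0" if k: "f k \<noteq> 0" for k
  proof (cases "k = 0")
    case False
    obtain i j where "f k i j \<noteq> 0"
      using k by (auto simp: fun_eq_iff)
    then have "k > 0"
      using f(4) False by blast
    have "(- k, i, j) \<notin> pos_cells" for i j
      using \<open>k > 0\<close> by (simp add: pos_cells_def)
    then have "g (- k) i j = 0" for i j
      using g(4)[of "- k" i j] pair_cells_pos[OF A, of C] by blast
    then have "g (- k) = 0"
      by (simp add: fun_eq_iff)
    then show ?thesis by simp
  qed simp
  then have "(\<Sum>k | f k \<noteq> 0. of_int k * killing n (f k) (g (- k))) = 0"
    by (intro sum.neutral) blast
  then have br: "aff_bracket n x y = (h, 0, 0)"
    unfolding f(1) g(1) aff_bracket_def h_def by (simp add: mat_scale_def fun_eq_iff)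
  have hso: "h m \<in> so n" for m
    unfolding h_def by (intro so_add so_sum so_scale so_bracket f(3) g(3))
  have cell: "(m, i, j) \<in> ?S" if nz: "h m i j \<noteq> 0" for m i j
  \<comment> \<open>The action of d only rescales entries of \<open>g\<close>; every other entry
    comes from a matrix product.\<close>
  proof (cases "g m i j = 0")
    case False
    then show ?thesis by (rule g(4))
  next
    case True
    have apply_sum: "(\<Sum>k\<in>K. F k) i j = (\<Sum>k\<in>K. F k i j)" for K :: "int set" and F :: "int \<Rightarrow> matrix"
      by (induction K rule: infinite_finite_induct) auto
    have "(\<Sum>k | f k \<noteq> 0. mat_bracket n (f k) (g (m - k)) i j) \<noteq> 0"
      using nz True unfolding h_def by (simp add: apply_sum mat_scale_def)
    then obtain k where "mat_bracket n (f k) (g (m - k)) i j \<noteq> 0"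
      by (meson sum.not_neutral_contains_not_neutral)
    then show ?thesis
    proof (rule mat_bracket_entry_nonzero)
      fix p assume p: "f k i p \<noteq> 0" "g (m - k) p j \<noteq> 0"
      have "(k + (m - k), i, j) \<in> ?S"
        by (rule pair_cells_left[OF A C com g(4)[OF p(2)] f(4)[OF p(1)]])
          (use so_nonzero[OF f(3) p(1)] so_nonzero[OF g(3) p(2)] so_nonzero[OF hso nz] in auto)
      then show ?thesis by simp
    next
      fix p assume p: "g (m - k) i p \<noteq> 0" "f k p j \<noteq> 0"
      have "(k + (m - k), i, j) \<in> ?S"
        by (rule pair_cells_right[OF A C com g(4)[OF p(1)] f(4)[OF p(2)]])
          (use so_nonzero[OF f(3) p(2)] so_nonzero[OF g(3) p(1)] so_nonzero[OF hso nz] in auto)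
      then show ?thesis by simp
    qed
  qed
  have "finite {m. h m \<noteq> 0}"
  proof (rule finite_subset)
    show "{m. h m \<noteq> 0} \<subseteq> {k. g k \<noteq> 0} \<union> (\<lambda>(k, l). k + l) ` ({k. f k \<noteq> 0} \<times> {k. g k \<noteq> 0})"
    proof
      fix m assume m: "m \<in> {m. h m \<noteq> 0}"
      show "m \<in> {k. g k \<noteq> 0} \<union> (\<lambda>(k, l). k + l) ` ({k. f k \<noteq> 0} \<times> {k. g k \<noteq> 0})"
      proof (rule ccontr)
        assume *: "\<not> ?thesis"
        have "g (m - k) = 0" if "f k \<noteq> 0" for k
          using * that by (auto simp: image_iff) (metis add_diff_cancel_left' diff_add_cancel add.commute)
        then have "(\<Sum>k | f k \<noteq> 0. mat_bracket n (f k) (g (m - k))) = 0"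
          by (intro sum.neutral) auto
        moreover have "g m = 0"
          using * by simp
        ultimately have "h m = 0"
          unfolding h_def by simp
        with m show False by simp
      qed
    qed
    show "finite ({k. g k \<noteq> 0} \<union> (\<lambda>(k, l). k + l) ` ({k. f k \<noteq> 0} \<times> {k. g k \<noteq> 0}))"
      using f(2) g(2) by simp
  qed
  then show ?thesis
    unfolding br coord_space_def using hso cell by auto
qed

section \<open>Finite codimension and the root space condition\<close>

lemma matrix_sum_apply: "(\<Sum>c\<in>X. F c :: matrix) i j = (\<Sum>c\<in>X. F c i j)"
  by (induction X rule: infinite_finite_induct) auto

text \<open>The factor 1/2 is there because (p, q) and its mirror (-q, -p) contribute the same
  matrix.\<close>

lemma so_expand:
  assumes "A \<in> so n"
  shows "A = (\<Sum>(p, q)\<in>{- int n..int n} \<times> {- int n..int n}. mat_scale (A p q / 2) (unit_mat p q))"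
proof (intro ext)
  fix i j
  let ?R = "{- int n..int n} \<times> {- int n..int n}"
  have "(\<Sum>(p, q)\<in>?R. mat_scale (A p q / 2) (unit_mat p q)) i j
      = (\<Sum>c\<in>?R. (if c = (i, j) then A i j / 2 else 0) - (if c = (- j, - i) then A (- j) (- i) / 2 else 0))"
    unfolding matrix_sum_apply
  proof (intro sum.cong refl)
    fix c :: "int \<times> int"
    obtain p q where c: "c = (p, q)" by (cases c)
    have e: "(i = p \<and> j = q) = ((p, q) = (i, j))" "(i = - q \<and> j = - p) = ((p, q) = (- j, - i))"
      unfolding prod.inject by linarith+
    have "A p q / 2 * (if (p, q) = (i, j) then 1 else 0) = (if (p, q) = (i, j) then A i j / 2 else 0)"
      by (cases "(p, q) = (i, j)") (simp_all only: prod.inject if_True if_False mult_1_right mult_zero_right simp_thms)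
    moreover have "A p q / 2 * (if (p, q) = (- j, - i) then 1 else 0) = (if (p, q) = (- j, - i) then A (- j) (- i) / 2 else 0)"
      by (cases "(p, q) = (- j, - i)") (simp_all only: prod.inject if_True if_False mult_1_right mult_zero_right simp_thms)
    ultimately show "(case c of (p, q) \<Rightarrow> mat_scale (A p q / 2) (unit_mat p q)) i j
        = (if c = (i, j) then A i j / 2 else 0) - (if c = (- j, - i) then A (- j) (- i) / 2 else 0)"
      by (simp only: c prod.case mat_scale_def unit_mat_def e right_diff_distrib)
  qed
  also have "\<dots> = (if (i, j) \<in> ?R then A i j / 2 else 0) - (if (- j, - i) \<in> ?R then A (- j) (- i) / 2 else 0)"
    unfolding sum_subtractf by (subst (1 2) sum.delta) auto
  also have "\<dots> = A i j"
    using so_nonzero(1,2)[OF assms, of i j] so_mirror[OF assms, of j i] by (cases "A i j = 0") auto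
  finally show "A i j = (\<Sum>(p, q)\<in>?R. mat_scale (A p q / 2) (unit_mat p q)) i j" ..
qed

lemma tensor_span:
  assumes "A \<in> so n" "\<And>i j. A i j \<noteq> 0 \<Longrightarrow> tensor_t (unit_mat i j) k \<in> F"
  shows "tensor_t A k \<in> aff.span F"
proof -
  have "tensor_t A k = (\<Sum>c\<in>{- int n..int n} \<times> {- int n..int n}.
      aff_scale (A (fst c) (snd c) / 2) (tensor_t (unit_mat (fst c) (snd c)) k))"
    by (subst so_expand[OF assms(1)]) (simp add: tensor_sum tensor_scale case_prod_beta)
  also have "\<dots> \<in> aff.span F"
  proof (intro aff.span_sum)
    fix c
    show "aff_scale (A (fst c) (snd c) / 2) (tensor_t (unit_mat (fst c) (snd c)) k) \<in> aff.span F"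
    proof (cases "A (fst c) (snd c) = 0")
      case True
      then show ?thesis by (simp add: aff.span_zero)
    next
      case False
      then show ?thesis by (intro aff.span_scale aff.span_base assms(2))
    qed
  qed
  finally show ?thesis .
qed

text \<open>Everything of degree at least 2 is in the ideal, so c, d and the finitely many unit
  tensors of degrees 0 and 1 suffice as additional generators.\<close>

lemma coord_space_finite_codim: "finite_codim (aff_borel n) (coord_space n (pair_cells A C))"
proof -
  let ?J = "coord_space n (pair_cells A C)"
  let ?u = "\<lambda>(k, i, j). tensor_t (unit_mat i j) k"
  let ?R = "{(k, i, j). (k = 1 \<or> k = 0 \<and> i \<le> j) \<and> \<bar>i\<bar> \<le> int n \<and> \<bar>j\<bar> \<le> int n}"
  define F where "F = {c_elem, d_elem} \<union> ?u ` ?R"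
  have "?R \<subseteq> {0, 1} \<times> {- int n..int n} \<times> {- int n..int n}"
    by auto
  then have "finite ?R"
    by (rule finite_subset) simp
  then have "finite F"
    unfolding F_def by (intro finite_UnI finite_imageI) auto
  moreover have "F \<subseteq> aff_borel n"
  proof -
    have "{c_elem, d_elem} \<subseteq> aff_cartan n"
      by (auto simp: aff_cartan_def intro: aff.span_base)
    then have "{c_elem, d_elem} \<subseteq> aff_borel n"
      using aff_cartan_borel by (rule subset_trans)
    moreover have "tensor_t (unit_mat i j) k \<in> aff_borel n"
      if "k = 1 \<or> k = 0 \<and> i \<le> j" "\<bar>i\<bar> \<le> int n" "\<bar>j\<bar> \<le> int n" for k i j
    proof (cases "k = 0 \<and> i = j")
      case True
      then show ?thesis
        using tensor_unit_cartan[OF that(2)] aff_cartan_borel by blast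
    next
      case False
      then show ?thesis
        using that by (intro tensor_unit_borel) (auto simp: pos_cells_def)
    qed
    ultimately show ?thesis
      by (auto simp: F_def)
  qed
  moreover have "aff_borel n \<subseteq> aff.span (?J \<union> F)"
  proof
    fix x assume "x \<in> aff_borel n"
    then obtain f a b where f: "x = (f, a, b)" "finite {k. f k \<noteq> 0}" "\<And>k. f k \<in> so n"
      "\<And>k i j. f k i j \<noteq> 0 \<Longrightarrow> k > 0 \<or> k = 0 \<and> i \<le> j"
      by (rule aff_borel_cases) blast
    define g where "g = (\<lambda>k. if k = 0 \<or> k = 1 then 0 else f k)"
    have "x = aff_scale a c_elem + aff_scale b d_elem + tensor_t (f 0) 0 + tensor_t (f 1) 1 + (g, 0, 0)"
      by (auto simp: f(1) g_def c_elem_def d_elem_def aff_scale_simp mat_scale_def tensor_t_def intro!: ext)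
    moreover have "tensor_t (f k) k \<in> aff.span (?J \<union> F)" if "k = 0 \<or> k = 1" for k
    proof (rule tensor_span[OF f(3)])
      fix i j assume nz: "f k i j \<noteq> 0"
      have "(k, i, j) \<in> ?R"
        using that so_nonzero(1,2)[OF f(3) nz] f(4)[OF nz] by auto
      then show "tensor_t (unit_mat i j) k \<in> ?J \<union> F"
        unfolding F_def by (intro UnI2 image_eqI[of _ ?u "(k, i, j)"]) auto
    qed
    moreover have "(g, 0, 0) \<in> ?J"
    proof -
      have "finite {k. g k \<noteq> 0}"
        by (rule finite_subset[OF _ f(2)]) (auto simp: g_def)
      moreover have "g k \<in> so n" for k
        by (simp add: g_def so_zero f(3))
      moreover have "(k, i, j) \<in> pair_cells A C" if "g k i j \<noteq> 0" for k i j
        using that f(4)[of k i j] by (auto simp: g_def pair_cells_def split: if_splits)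
      ultimately show ?thesis
        by (simp add: coord_space_def)
    qed
    ultimately show "x \<in> aff.span (?J \<union> F)"
      by (auto simp: F_def intro!: aff.span_add aff.span_scale intro: aff.span_base)
  qed
  ultimately show ?thesis
    unfolding finite_codim_def by blast
qed

text \<open>The cells of one weight are a cell and its mirror, or the diagonal cells of one positive
  degree, and \<open>pair_cells\<close> is closed under both.\<close>

lemma root_space_pair_cells:
  assumes A: "A \<in> upper_sets n" and c: "(k, i, j) \<in> pair_cells A C" "\<bar>i\<bar> \<le> int n" "\<bar>j\<bar> \<le> int n"
  shows "aff_root_space n (cell_weight n (k, i, j)) \<subseteq> coord_space n (pair_cells A C)"
proof
  fix y assume y: "y \<in> aff_root_space n (cell_weight n (k, i, j))"
  obtain f a b where f: "y = (f, a, b)" by (cases y)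
  note D = root_spaceD[OF y[unfolded f] cell_weight_dual]
  have pos: "(k, i, j) \<in> pos_cells"
    using pair_cells_pos[OF A] c(1) by blast
  have "(k', i', j') \<in> pair_cells A C" if nz: "f k' i' j' \<noteq> 0" for k' i' j'
  proof -
    note w = cell_weight_eq[OF D(3)[OF nz] c(2,3) so_nonzero(1,2)[OF D(2) nz]]
    consider "i' = i" "j' = j" | "i' = - j" "j' = - i" | "i = j" "i' = j'"
      using w(2) by auto
    then show ?thesis
    proof cases
      case 3
      then have "k \<ge> 1"
        using pos by (auto simp: pos_cells_def)
      then show ?thesis
        using 3 w(1) by (auto simp: pair_cells_def)
    qed (use c(1) w(1) in \<open>auto simp: pair_cells_mirror\<close>)
  qed
  then show "y \<in> coord_space n (pair_cells A C)"
    using D pos_cell_weight_nonzero[OF pos c(2,3)] unfolding f coord_space_def by auto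
qed

lemma coord_space_basic_ideal:
  assumes n: "n \<ge> 1" and A: "A \<in> upper_sets n" and C: "C \<in> upper_sets n" and com: "commuting n A C"
  shows "basic_ideal n (coord_space n (pair_cells A C))"
proof -
  let ?J = "coord_space n (pair_cells A C)"
  have nilp: "?J \<subseteq> aff_nilp n"
    unfolding aff_nilp_coord coord_space_def using pair_cells_pos[OF A, of C] by auto
  have "?J \<inter> aff_root_space n \<alpha> \<in> {{0}, aff_root_space n \<alpha>}" if \<alpha>: "\<alpha> \<in> aff_pos_roots n" for \<alpha>
  proof (cases "?J \<inter> aff_root_space n \<alpha> \<subseteq> {0}")
    case True
    have "0 \<in> ?J"
      using coord_space_subspace by (rule aff.subspace_0)
    moreover have "0 \<in> aff_root_space n \<alpha>"
      using root_spaceI[of 0 n \<alpha>] by (simp add: so_zero zero_prod_def)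
    ultimately show ?thesis
      using True by auto
  next
    case False
    then obtain x where x: "x \<in> ?J" "x \<in> aff_root_space n \<alpha>" "x \<noteq> 0"
      by blast
    then obtain f where f: "x = (f, 0, 0)" "\<And>k. f k \<in> so n" "\<And>k i j. f k i j \<noteq> 0 \<Longrightarrow> (k, i, j) \<in> pair_cells A C"
      unfolding coord_space_def by auto
    have "f \<noteq> 0"
      using x(3) f(1) by (auto simp: zero_prod_def)
    then obtain k i j where nz: "f k i j \<noteq> 0"
      by (auto simp: fun_eq_iff)
    have "\<alpha> \<in> dual_space aff_scale (aff_cartan n)"
      using \<alpha> by (simp add: aff_pos_roots_def roots_def)
    then have "\<alpha> = cell_weight n (k, i, j)"
      using root_spaceD(3)[OF x(2)[unfolded f(1)] _ nz] by blast
    then have "aff_root_space n \<alpha> \<subseteq> ?J"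
      using root_space_pair_cells[OF A f(3)[OF nz] so_nonzero(1,2)[OF f(2) nz]] by simp
    then show ?thesis by blast
  qed
  moreover have "borel_ideal n ?J"
    unfolding borel_ideal_def
    using coord_space_subspace nilp aff_nilp_borel coord_space_ideal[OF A C com] by blast
  ultimately have "combinatorial_ideal n ?J"
    using nilp coord_space_finite_codim by (simp add: combinatorial_ideal_def)
  moreover have "delta n \<in> supp n ?J"
  proof -
    have d: "delta n = cell_weight n (1, 1, 1)"
      by (rule delta_cell_weight)
    have "tensor_t (unit_mat 1 1) 1 \<noteq> 0"
    proof
      assume "tensor_t (unit_mat 1 1) 1 = 0"
      then have "fst (tensor_t (unit_mat 1 1) 1) 1 1 1 = 0"
        by simp
      then show False
        by (simp add: tensor_apply unit_mat_def)
    qed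
    then have "delta n \<in> aff_pos_roots n"
      unfolding d using n tensor_unit_root_space[of 1 n 1 1]
      by (intro pos_cell_weight) (auto simp: pos_cells_def)
    moreover have "aff_root_space n (delta n) \<subseteq> ?J"
      unfolding d using n by (intro root_space_pair_cells[OF A]) (auto simp: pair_cells_def)
    ultimately show ?thesis
      by (simp add: supp_def)
  qed
  then have "supp n ?J \<inter> basic_roots n \<noteq> {}"
    by (auto simp: basic_roots_def Let_def)
  ultimately show ?thesis
    by (simp add: basic_ideal_def)
qed

section \<open>From a basic ideal back to a pair\<close>

context comb_ideal
begin

text \<open>When \<open>r = - p\<close>, the position \<open>(r, p)\<close> that would connect the two cells lies on the antidiagonal,
  where the elements of \<open>so n\<close> vanish, so the proof passes through row \<open>0\<close>.\<close>

lemma support_extend_left: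
  assumes S: "(l, p, q) \<in> support" "p \<noteq> q" and r: "r \<le> p" "\<bar>r\<bar> \<le> int n" "r \<noteq> - q" "q \<noteq> 0 \<or> r \<noteq> - p"
  shows "(l, r, q) \<in> support"
proof -
  consider "r = p" | "r < p" "r \<noteq> - p" | "r < p" "r = - p"
    using r(1) by linarith
  then show ?thesis
  proof cases
    case 1
    then show ?thesis using S by simp
  next
    case 2
    have "(0 + l, r, q) \<in> support"
      by (rule support_left[OF S]) (use 2 r in \<open>auto simp: pos_cells_def\<close>)
    then show ?thesis by simp
  next
    case 3
    have "(0 + l, 0, q) \<in> support"
      by (rule support_left[OF S]) (use 3 r in \<open>auto simp: pos_cells_def\<close>)
    then have "(0 + l, r, q) \<in> support"
      by (intro support_left[of l 0 q]) (use 3 r in \<open>auto simp: pos_cells_def\<close>)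
    then show ?thesis by simp
  qed
qed

lemma support_extend_right:
  assumes S: "(l, p, q) \<in> support" "p \<noteq> q" and s: "q \<le> s" "\<bar>s\<bar> \<le> int n" "s \<noteq> - p" "p \<noteq> 0 \<or> s \<noteq> - q"
  shows "(l, p, s) \<in> support"
proof -
  have "(l, - s, - p) \<in> support"
    by (rule support_extend_left[OF support_cell(5)[OF S(1)]]) (use S(2) s in auto)
  then show ?thesis
    using support_cell(5)[of l "- s" "- p"] by simp
qed

definition low :: "(int \<times> int) set" where
  "low = {(i, j). (i, j) \<in> cells n \<and> (0, - i, j) \<in> support}"

text \<open>The cell (1, j, -i) has weight \<delta> minus the root of (i, j). These roots get
  smaller as \<delta> - \<gamma> grows, so the complement is taken to obtain an upper set.\<close>

definition high :: "(int \<times> int) set" where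
  "high = {(i, j). (i, j) \<in> cells n \<and> (1, j, - i) \<notin> support}"

lemma low_upper: "low \<in> upper_sets n"
  unfolding upper_sets_def
proof (intro CollectI conjI allI impI)
  fix i j i' j' assume *: "(i, j) \<in> low" "i \<le> i'" "i' \<le> int n" "j \<le> j'" "j' < i'"
  then have S: "(0, - i, j) \<in> support" and ij: "1 \<le> i" "\<bar>j\<bar> < i"
    by (auto simp: low_def cells_def)
  have "(0, - i', j) \<in> support"
    by (rule support_extend_left[OF S]) (use * ij in auto)
  then have "(0, - i', j') \<in> support"
    by (rule support_extend_right) (use * ij in auto)
  then show "(i', j') \<in> low"
    using * ij by (auto simp: low_def cells_def)
qed (auto simp: low_def)

lemma high_upper: "high \<in> upper_sets n"
  unfolding upper_sets_def
proof (intro CollectI conjI allI impI)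
  fix i j i' j' assume *: "(i, j) \<in> high" "i \<le> i'" "i' \<le> int n" "j \<le> j'" "j' < i'"
  then have S: "(1, j, - i) \<notin> support" and ij: "1 \<le> i" "\<bar>j\<bar> < i"
    by (auto simp: high_def cells_def)
  have "(1, j', - i') \<notin> support"
  proof
    assume S': "(1, j', - i') \<in> support"
    have "(1, j, - i') \<in> support"
      by (rule support_extend_left[OF S']) (use * ij in auto)
    then have "(1, j, - i) \<in> support"
      by (rule support_extend_right) (use * ij in auto)
    with S show False ..
  qed
  then show "(i', j') \<in> high"
    using * ij by (auto simp: high_def cells_def)
qed (auto simp: high_def)

text \<open>Let \<theta> be the highest root. If \<gamma> is in \<open>low\<close>, the bracket with
  the root vector of \<delta> - \<theta> puts \<delta> - (\<theta> - \<gamma>) into the support, so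
  \<theta> - \<gamma> is not in \<open>high\<close>.\<close>

lemma low_high_commuting:
  assumes "n \<ge> 2"
  shows "commuting n low high"
  unfolding commuting_def
proof (intro allI impI conjI)
  fix j assume j: "\<bar>j\<bar> \<le> int n - 2"
  show "\<not> ((int n - 1, j) \<in> low \<and> (int n, - j) \<in> high)"
  proof
    assume "(int n - 1, j) \<in> low \<and> (int n, - j) \<in> high"
    then have S: "(0, - (int n - 1), j) \<in> support" "(1, - j, - int n) \<notin> support"
      by (auto simp: low_def high_def)
    have "(1 + 0, int n, j) \<in> support"
      by (rule support_left[OF S(1)]) (use j assms in \<open>auto simp: pos_cells_def\<close>)
    then show False
      using support_cell(5)[of 1 "int n" j] S(2) by simp
  qed
  show "\<not> ((int n, - j) \<in> low \<and> (int n - 1, j) \<in> high)"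
  proof
    assume "(int n, - j) \<in> low \<and> (int n - 1, j) \<in> high"
    then have S: "(0, - int n, - j) \<in> support" "(1, j, - (int n - 1)) \<notin> support"
      by (auto simp: low_def high_def)
    have "(1 + 0, int n - 1, - j) \<in> support"
      by (rule support_left[OF S(1)]) (use j assms in \<open>auto simp: pos_cells_def\<close>)
    then show False
      using support_cell(5)[of 1 "int n - 1" "- j"] S(2) by simp
  qed
qed

lemma positions_low: "(p, q) \<in> positions low \<longleftrightarrow> (0, p, q) \<in> support"
proof -
  have m: "(0, - q, - p) \<in> support \<longleftrightarrow> (0, p, q) \<in> support"
    using support_cell(5)[of 0 p q] support_cell(5)[of 0 "- q" "- p"] by auto
  show ?thesis
  proof
    assume "(p, q) \<in> positions low"
    then show "(0, p, q) \<in> support"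
      using m by (auto simp: positions_def low_def)
  next
    assume S: "(0, p, q) \<in> support"
    then show "(p, q) \<in> positions low"
      using support_cell(1-4)[OF S] m by (auto simp: positions_def low_def cells_def pos_cells_def)
  qed
qed

lemma positions_high:
  assumes "p < q" "p \<noteq> - q" "\<bar>p\<bar> \<le> int n" "\<bar>q\<bar> \<le> int n"
  shows "(p, q) \<in> positions high \<longleftrightarrow> (1, q, p) \<notin> support"
proof -
  have m: "(1, - p, - q) \<in> support \<longleftrightarrow> (1, q, p) \<in> support"
    using support_cell(5)[of 1 q p] support_cell(5)[of 1 "- p" "- q"] by auto
  show ?thesis
    using m assms by (auto simp: positions_def high_def cells_def)
qed

lemma eq_pair_cells:
  assumes n: "n \<ge> 1" and d: "(1, r, r) \<in> support"
  shows "I = coord_space n (pair_cells low high)"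
proof -
  have eq: "(k, i, j) \<in> support \<longleftrightarrow> (k, i, j) \<in> pair_cells low high"
    if ij: "\<bar>i\<bar> \<le> int n" "\<bar>j\<bar> \<le> int n" "i \<noteq> - j" for k i j
  proof -
    consider "k \<ge> 2 \<or> k = 1 \<and> i \<le> j" | "k = 1" "j < i" | "k = 0" | "k < 0"
      by linarith
    then show ?thesis
    proof cases
      case 1
      then show ?thesis
        using support_above_delta[OF n d 1 ij] by (auto simp: pair_cells_def)
    next
      case 2
      then show ?thesis
        using positions_high[of j i] ij by (auto simp: pair_cells_def)
    next
      case 3
      then show ?thesis
        by (auto simp: pair_cells_def positions_low)
    next
      case 4
      then show ?thesis
        using support_cell(4)[of k i j] by (auto simp: pair_cells_def pos_cells_def)
    qed
  qed
  \<comment> \<open>The two sets agree wherever a matrix in \<open>so n\<close> can be nonzero, and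
    only these positions matter.\<close>
  have "coord_space n support = coord_space n (pair_cells low high)"
    unfolding coord_space_def using eq so_nonzero(1-3) by (intro Collect_cong) blast
  then show ?thesis
    using eq_coord_space by simp
qed

end

section \<open>The bijection and the count\<close>

lemma bij_basic_ideals:
  assumes "n \<ge> 2"
  shows "bij_betw (\<lambda>(A, C). coord_space n (pair_cells A C))
    {(A, C). A \<in> upper_sets n \<and> C \<in> upper_sets n \<and> commuting n A C} {I. basic_ideal n I}"
proof (rule bij_betw_imageI)
  show "inj_on (\<lambda>(A, C). coord_space n (pair_cells A C))
      {(A, C). A \<in> upper_sets n \<and> C \<in> upper_sets n \<and> commuting n A C}"
    using coord_space_pair_cells_inj by (intro inj_onI) (clarify, blast)
  show "(\<lambda>(A, C). coord_space n (pair_cells A C)) `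
      {(A, C). A \<in> upper_sets n \<and> C \<in> upper_sets n \<and> commuting n A C} = {I. basic_ideal n I}"
  proof (intro equalityI subsetI)
    fix I assume "I \<in> (\<lambda>(A, C). coord_space n (pair_cells A C)) `
      {(A, C). A \<in> upper_sets n \<and> C \<in> upper_sets n \<and> commuting n A C}"
    then show "I \<in> {I. basic_ideal n I}"
      using assms by (auto intro!: coord_space_basic_ideal)
  next
    fix I assume "I \<in> {I. basic_ideal n I}"
    then have I: "basic_ideal n I" by simp
    interpret comb_ideal n I
      using I by (intro comb_idealI) (simp add: basic_ideal_def)
    obtain r where "(1, r, r) \<in> support"
      using basic_ideal_delta[OF _ I] assms by auto
    then have "I = coord_space n (pair_cells low high)"
      using assms by (intro eq_pair_cells) auto
    then show "I \<in> (\<lambda>(A, C). coord_space n (pair_cells A C)) `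
      {(A, C). A \<in> upper_sets n \<and> C \<in> upper_sets n \<and> commuting n A C}"
      using low_upper high_upper low_high_commuting[OF assms] by (intro image_eqI[of _ _ "(low, high)"]) auto
  qed
qed

theorem theorem1:
  fixes n :: nat
  assumes "n \<ge> 2"
  shows "int (card {I. basic_ideal n I})
    = (3 * int n + 5) * 2 ^ (2 * n - 2) - 2 * (3 * int n - 1) * int ((2 * n - 2) choose (n - 1))"
proof -
  obtain m where m: "n = m + 2"
    using assms by (metis add.commute le_Suc_ex)
  have "2 * n - 2 = 2 * m + 2" "n - 1 = m + 1"
    using m by simp_all
  moreover have "3 * int n + 5 = 3 * int m + 11" "3 * int n - 1 = 3 * int m + 5"
    using m by simp_all
  moreover have "card {I. basic_ideal n I}
      = card {(A, C). A \<in> upper_sets n \<and> C \<in> upper_sets n \<and> commuting n A C}"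
    using bij_betw_same_card[OF bij_basic_ideals[OF assms]] by simp
  ultimately show ?thesis
    using card_commuting[of m] by (simp only: m)
qed

end
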